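(* Let $s$ be an integer with $2 \le s \le 8896$ and let $n \ge 1$ be an integer. If the $s$-Cullen number $C_{n,s} = n s^n + 1$ is a repunit, then either $n = 1$ (so that $C_{1,s} = s+1$, i.e. $s$ is one less than a repunit), or $n = 2$ and $s^2 = \frac{b(b+1)}{2}$ for some integer $b \ge 2$ (so that $C_{2,s} = 2s^2+1 = b^2+b+1$).
   Context: For integers $s \ge 2$ and $n \ge 1$, the $s$-Cullen numbers are the numbers $C_{n,s} = n s^n + 1$. A positive integer $m$ is called a repunit if there exist integers $b \ge 2$ and $q \ge 3$ such that $m = \frac{b^q-1}{b-1} = b^{q-1} + b^{q-2} + \cdots + b + 1$. *)

theory Defs
  imports Main
begin

definition cullen :: "nat \<Rightarrow> nat \<Rightarrow> nat" where
  "cullen n s = n * s ^ n + 1"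

text \<open>The requirement \<open>q \<ge> 3\<close> is essential: with \<open>q = 2\<close> every \<open>m \<ge> 3\<close> would qualify.
  Neither the subtraction nor the division loses anything, as the lemmas below show.\<close>

definition repunit :: "nat \<Rightarrow> bool" where
  "repunit m \<longleftrightarrow> (\<exists>b q. b \<ge> 2 \<and> q \<ge> 3 \<and> m = (b ^ q - 1) div (b - 1))"

lemma repunit_mult:
  fixes b q :: nat
  assumes "b \<ge> 2"
  shows "b ^ q - 1 = (b - 1) * (\<Sum>i<q. b ^ i)"
proof -
  have "(b - 1) * (\<Sum>i<q. b ^ i) + 1 = b ^ q"
  proof (induction q)
    case (Suc q)
    have "(b - 1) * b ^ q + b ^ q = b ^ Suc q"
      using assms by (cases b) auto
    with Suc show ?case by (simp add: algebra_simps)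
  qed simp
  then show ?thesis by linarith
qed

lemma repunit_iff_sum:
  "repunit m \<longleftrightarrow> (\<exists>b q. b \<ge> 2 \<and> q \<ge> 3 \<and> m = (\<Sum>i<q. b ^ i))"
proof -
  have "(b ^ q - 1) div (b - 1) = (\<Sum>i<q. b ^ i)" if "b \<ge> 2" for b q :: nat
    using that unfolding repunit_mult[OF that] by (intro nonzero_mult_div_cancel_left) simp
  then show ?thesis
    unfolding repunit_def by metis
qed

end

theory Submission
  imports Defs Complex_Main "HOL-Number_Theory.Number_Theory" "HOL-Computational_Algebra.Nth_Powers"
begin

text \<open>Write \<open>geom m b\<close> for \<open>1 + b + \<dots> + b ^ (m - 1)\<close>. If \<open>n s\<^sup>n + 1\<close> is a repunit with \<open>m + 1 \<ge> 3\<close>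
digits in base \<open>b\<close>, then \<open>n s\<^sup>n = b \<cdot> geom m b\<close>. The two factors on the right are coprime, hence
\<open>b = n1 u\<^sup>n\<close> and \<open>geom m b = n2 v\<^sup>n\<close> with \<open>n = n1 n2\<close> and \<open>s = u v\<close>. For \<open>n = 2\<close> and \<open>m = 2\<close> this
is the family in the conclusion; everything else with \<open>n \<ge> 2\<close> has to be excluded.

If \<open>u = 1\<close>, the base \<open>b = n1\<close> divides \<open>n\<close>, and no bound on \<open>n\<close> is available, so a structural argument
is needed (\<open>no_solution_b_dvd_n\<close>). Let \<open>\<rho>\<close> be the largest prime factor of \<open>m\<close>. For every \<open>k\<close> with
\<open>k \<rho> dvd m\<close> the factor \<open>geom \<rho> (b ^ k)\<close> of \<open>geom m b\<close> shares no prime except \<open>\<rho>\<close> with its cofactor, so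
each prime of \<open>v\<close> other than \<open>\<rho>\<close> that divides the factor does so with exponent at least \<open>n\<close>. For \<open>k = 1\<close> that would make
\<open>geom \<rho> b\<close> an \<open>n\<close>-th power, which is impossible modulo a power of a prime of \<open>b\<close>
(\<open>geom_not_power\<close>). Consequently the factor for \<open>k = 1\<close> is essentially a divisor of \<open>n2\<close>, which makes
\<open>n = b n2\<close> so large that no prime power \<open>p\<^sup>n\<close> fits into the factor for the next \<open>k\<close>, and so on up to
\<open>k = m / \<rho>\<close>, where finally \<open>v\<^sup>n\<close> itself does not fit into \<open>geom m b\<close>.

If \<open>u \<ge> 2\<close>, the size of \<open>b \<ge> u\<^sup>n\<close> forces \<open>u ^ m \<le> 13344\<close>, so \<open>m \<le> 13\<close> and few \<open>u\<close> remain. A factor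
\<open>geom \<rho> (b ^ k)\<close> has the form \<open>C y\<^sup>n\<close> with \<open>y dvd v\<close> and \<open>C\<close> a divisor of \<open>\<rho> n\<close> (\<open>extract_factor\<close>).
Since it is about \<open>n1 ^ D w\<^sup>n\<close> for \<open>w = u ^ D\<close>, \<open>D = k (\<rho> - 1)\<close>, the ratio \<open>(y / w)\<^sup>n\<close> is polynomially
bounded in \<open>n\<close>; as \<open>y \<noteq> w\<close>, this bounds \<open>n\<close> explicitly (\<open>exponent_bound\<close>). For each remaining pair
\<open>(u, y)\<close> and each \<open>n\<close>, the congruence \<open>C y\<^sup>n \<equiv> 1 (mod u\<^sup>n)\<close> determines the small number \<open>C\<close>, and it turns
out never to be a divisor of \<open>\<rho> n\<close> that satisfies the congruence to higher precision. This finite search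
is carried out by rewriting with a verified program (\<open>check_u_sound\<close>). For \<open>n = 2\<close> it is enough to
test a few pairs \<open>(u, m)\<close>. For \<open>m = 2\<close> the most
expensive pairs, \<open>v = u + 1\<close> and \<open>v = u - 1\<close>, are excluded by hand: there \<open>n2 \<equiv> \<plusminus>1 (mod u)\<close> and
\<open>n1 \<equiv> \<plusminus>1 (mod v)\<close>, so \<open>n = n1 n2\<close> is of order \<open>u\<^sup>2\<close>, against the exponential growth of \<open>(1 + 1/u)\<^sup>n\<close>.\<close>

section \<open>Repunits and their prime divisors\<close>

definition geom :: "nat \<Rightarrow> nat \<Rightarrow> nat" where
  "geom m b = (\<Sum>i<m. b ^ i)"

lemma geom_0 [simp]: "geom 0 b = 0" and geom_1 [simp]: "geom (Suc 0) b = 1"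
  by (simp_all add: geom_def)

lemma geom_Suc: "geom (Suc m) b = 1 + b * geom m b"
  unfolding geom_def by (subst sum.lessThan_Suc_shift) (simp add: sum_distrib_left)

lemma geom_Suc_top: "geom (Suc m) b = geom m b + b ^ m"
  by (simp add: geom_def)

lemma geom_2: "geom 2 b = 1 + b"
  by (simp add: geom_Suc eval_nat_numeral)

lemma geom_add: "geom (i + j) b = geom i b + b ^ i * geom j b"
  by (induction j) (simp_all add: geom_Suc_top power_add algebra_simps)

lemma geom_mult: "geom (j * k) b = geom j b * geom k (b ^ j)"
proof (induction k)
  case (Suc k)
  have "geom (j * Suc k) b = geom (j * k + j) b" by (simp add: algebra_simps)
  also have "\<dots> = geom (j * k) b + b ^ (j * k) * geom j b" by (rule geom_add)
  also have "\<dots> = geom j b * (geom k (b ^ j) + (b ^ j) ^ k)"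
    by (simp add: Suc algebra_simps power_mult)
  finally show ?case by (simp add: geom_Suc_top)
qed simp

lemma geom_geometric: "b \<ge> 1 \<Longrightarrow> (b - 1) * geom m b + 1 = b ^ m"
proof (induction m)
  case (Suc m)
  have "(b - 1) * geom (Suc m) b + 1 = ((b - 1) * geom m b + 1) + (b - 1) * b ^ m"
    by (simp add: geom_Suc_top distrib_left)
  also have "\<dots> = (b - 1) * b ^ m + b ^ m"
    using Suc by simp
  also have "\<dots> = b ^ Suc m"
    using Suc.prems by (cases b) auto
  finally show ?case .
qed simp

lemma geom_less: "b \<ge> 2 \<Longrightarrow> geom m b < b ^ m"
proof -
  assume b: "b \<ge> 2"
  have "1 * geom m b \<le> (b - 1) * geom m b" using b by (intro mult_right_mono) auto
  with geom_geometric[of b m] b show ?thesis by linarith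
qed

lemma geom_ge_power: "geom (Suc m) b \<ge> b ^ m"
  by (simp add: geom_Suc_top)

lemma geom_pos: "m > 0 \<Longrightarrow> geom m b > 0"
  by (cases m) (simp_all add: geom_Suc)

lemma geom_cong_one: "[T = 1] (mod p) \<Longrightarrow> [geom m T = m] (mod p)"
proof (induction m)
  case (Suc m)
  then have "[1 + T * geom m T = 1 + 1 * m] (mod p)"
    by (intro cong_add cong_mult) auto
  then show ?case by (simp add: geom_Suc)
qed simp

lemma geom_dvd_power_cong: "T \<ge> 1 \<Longrightarrow> p dvd geom m T \<Longrightarrow> [T ^ m = 1] (mod p)"
  using geom_geometric[of T m] cong_add[of "(T - 1) * geom m T" 0 p 1 1] by (simp add: cong_0_iff)

lemma coprime_geom:
  assumes "m > 0" shows "coprime b (geom m b)"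
proof (rule coprimeI)
  fix c assume c: "c dvd b" "c dvd geom m b"
  obtain k where "m = Suc k" using assms gr0_implies_Suc by blast
  then have "c dvd 1 + b * geom k b" using c(2) by (simp add: geom_Suc)
  moreover have "c dvd b * geom k b" using c(1) by simp
  ultimately show "is_unit c" using dvd_add_left_iff by blast
qed

text \<open>If \<open>T\<close> is not \<open>1\<close> modulo \<open>p\<close>, its order modulo \<open>p\<close> is the prime \<open>\<rho>\<close>, and the order divides \<open>p - 1\<close>.\<close>

lemma prime_dvd_geom_prime:
  assumes "prime p" "prime \<rho>" "T \<ge> 1" "p dvd geom \<rho> T"
  shows "p = \<rho> \<or> \<rho> dvd p - 1"
proof (cases "[T = 1] (mod p)")
  case True
  then have "p dvd \<rho>" using geom_cong_one[OF True, of \<rho>] assms(4) cong_dvd_iff by blast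
  then show ?thesis using assms by (simp add: primes_dvd_imp_eq)
next
  case False
  have c: "[T ^ \<rho> = 1] (mod p)" using geom_dvd_power_cong assms by blast
  then have "ord p T dvd \<rho>" using ord_divides by blast
  moreover have "ord p T \<noteq> 1" using False ord_works[of T p] by auto
  ultimately have o: "ord p T = \<rho>" using assms(2) by (metis prime_nat_iff)
  have "\<not> p dvd T"
  proof
    assume "p dvd T"
    then have "p dvd T ^ \<rho>" using assms(2) prime_gt_0_nat by (metis dvd_power dvd_trans)
    then have "p dvd 1" using c cong_dvd_iff by blast
    then show False using assms(1) by simp
  qed
  then have "coprime p T" using assms(1) by (simp add: prime_imp_coprime)
  then show ?thesis using order_divides_totient[of p T] o assms(1) by (simp add: totient_prime)
qed

text \<open>The cofactor of \<open>geom \<rho> (b ^ k)\<close> in \<open>geom (k * \<rho> * t) b\<close> is \<open>geom k b * geom t (b ^ (k * \<rho>))\<close>. A prime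
\<open>p \<noteq> \<rho>\<close> dividing \<open>geom \<rho> (b ^ k)\<close> exceeds \<open>\<rho>\<close>; it would divide \<open>t\<close> if it divided the second part, because
\<open>b ^ (k * \<rho>)\<close> is \<open>1\<close> modulo \<open>p\<close>.\<close>

lemma prime_dvd_cofactor:
  assumes p: "prime p" and r: "prime \<rho>" and b: "b \<ge> 1"
    and t: "t > 0" "\<And>q. prime q \<Longrightarrow> q dvd t \<Longrightarrow> q \<le> \<rho>"
    and d: "p dvd geom \<rho> (b ^ k)" and d': "p dvd geom k b * geom t (b ^ (k * \<rho>))"
  shows "p = \<rho>"
proof (rule ccontr)
  assume ne: "p \<noteq> \<rho>"
  have T: "b ^ k \<ge> 1" using b by simp
  have nT: "\<not> [b ^ k = 1] (mod p)"
  proof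
    assume "[b ^ k = 1] (mod p)"
    then have "p dvd \<rho>" using geom_cong_one d cong_dvd_iff by blast
    then show False using ne p r by (simp add: primes_dvd_imp_eq)
  qed
  have "\<not> p dvd geom k b" using nT geom_dvd_power_cong b by blast
  then have "p dvd geom t ((b ^ k) ^ \<rho>)" using d' p by (simp add: prime_dvd_mult_iff power_mult)
  moreover have "[(b ^ k) ^ \<rho> = 1] (mod p)" using geom_dvd_power_cong[OF T d] .
  ultimately have "p dvd t" using geom_cong_one cong_dvd_iff by blast
  then have "p \<le> \<rho>" using t p by blast
  moreover have "\<rho> dvd p - 1" using prime_dvd_geom_prime[OF p r T d] ne by blast
  then have "\<rho> \<le> p - 1" using p prime_gt_1_nat[of p] by (intro dvd_imp_le) auto
  ultimately show False using prime_gt_0_nat[OF p] by linarith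
qed

text \<open>Taking an \<open>r\<close>-th power gains one factor \<open>r\<close>: \<open>x ^ r - 1 = (x - 1) * geom r x\<close>, and \<open>r\<close> divides the last factor.\<close>

lemma cong_power_prime_step:
  assumes "prime (r::nat)" "[x = 1] (mod r ^ Suc i)"
  shows "[x ^ r = 1] (mod r ^ Suc (Suc i))"
proof (cases "x = 0")
  case True
  then have "r ^ Suc i dvd 1" using assms(2) by (simp add: cong_0_iff cong_sym_eq[of 0] del: power_Suc)
  then show ?thesis using assms(1) by simp
next
  case False
  then have g: "(x - 1) * geom r x + 1 = x ^ r" by (intro geom_geometric) simp
  have "r ^ Suc i dvd x - 1" using assms(2) False cong_altdef_nat[of 1 x "r ^ Suc i"] cong_sym by auto
  moreover have x1: "[x = 1] (mod r)" using assms(2) by (rule cong_dvd_modulus_nat) simp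
  have "r dvd geom r x" using geom_cong_one[OF x1, of r] by (simp add: cong_dvd_iff)
  ultimately have "r ^ Suc i * r dvd (x - 1) * geom r x" by (rule mult_dvd_mono)
  then have "[(x - 1) * geom r x + 1 = 0 + 1] (mod r ^ Suc (Suc i))"
    by (intro cong_add) (simp_all add: cong_0_iff mult.commute)
  then show ?thesis using g by simp
qed

lemma cong_power_prime_pow:
  assumes "prime (r::nat)" "[x = 1] (mod r)"
  shows "[x ^ (r ^ a) = 1] (mod r ^ Suc a)"
proof (induction a)
  case (Suc a)
  from cong_power_prime_step[OF assms(1) Suc] show ?case
    by (simp add: power_mult[symmetric] mult.commute)
next
  case 0
  show ?case using assms by simp
qed

lemma fermat_cong:
  assumes "prime (r::nat)" shows "[x ^ r = x] (mod r)"
proof (cases "r dvd x")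
  case True
  then have "r dvd x ^ r" using prime_gt_0_nat[OF assms] by (simp add: dvd_power_iff dvd_trans[OF _ dvd_power])
  with True show ?thesis by (simp add: cong_def)
next
  case False
  then have "[x ^ (r - 1) = 1] (mod r)" using fermat_theorem assms by blast
  then have "[x ^ (r - 1) * x = 1 * x] (mod r)" by (intro cong_mult) auto
  then show ?thesis using power_minus_mult[OF prime_gt_0_nat[OF assms], of x] by simp
qed

lemma fermat_cong_pow: "prime (r::nat) \<Longrightarrow> [x ^ (r ^ a) = x] (mod r)"
proof (induction a)
  case (Suc a)
  then have "[(x ^ (r ^ a)) ^ r = x ^ (r ^ a)] (mod r)" by (intro fermat_cong)
  with Suc show ?case by (simp add: power_mult[symmetric] mult.commute) (meson cong_trans)
qed simp

text \<open>Let \<open>r ^ a\<close> be the exact power of a prime \<open>r\<close> in \<open>b\<close>. Then \<open>geom m b \<equiv> 1 + b\<close> modulo \<open>r ^ (a + 1)\<close>, which is not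
\<open>1\<close>. But \<open>y ^ n\<close> is an \<open>r ^ a\<close>-th power that is \<open>1\<close> modulo \<open>r\<close>, hence \<open>1\<close> modulo \<open>r ^ (a + 1)\<close>.\<close>

lemma geom_not_power:
  assumes b: "b \<ge> 2" and m: "m \<ge> 2" and n: "b dvd n"
  shows "geom m b \<noteq> y ^ n"
proof
  assume eq: "geom m b = y ^ n"
  obtain r where r: "prime r" "r dvd b" using b prime_factor_nat[of b] by auto
  define a where "a = multiplicity r b"
  have nb: "b \<noteq> 0" "\<not> is_unit r" using b r(1) by auto
  have ra: "r ^ a dvd b" unfolding a_def by (rule multiplicity_dvd)
  have ra': "\<not> r ^ Suc a dvd b"
    using multiplicity_geI[OF nb, of "Suc a"] unfolding a_def by linarith
  have a1: "a \<ge> 1" using multiplicity_geI[OF nb, of 1] r(2) unfolding a_def by simp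
  from ra n obtain c where c: "n = r ^ a * c" by (meson dvd_def dvd_trans)
  define x where "x = y ^ c"
  have yx: "y ^ n = x ^ (r ^ a)" unfolding x_def c by (simp add: power_mult[symmetric] mult.commute)
  define m' where "m' = m - 2"
  have m': "m = Suc (Suc m')" using m by (simp add: m'_def)
  have Rm: "geom m b = (1 + b) + b * b * geom m' b" by (simp add: m' geom_Suc algebra_simps)
  have "r ^ Suc a dvd b * b" using mult_dvd_mono[OF r(2) ra] by simp
  then have c1: "[geom m b = 1 + b] (mod r ^ Suc a)"
    unfolding Rm using cong_add[OF cong_refl[of "1 + b"], of "b * b * geom m' b" 0]
    by (simp add: cong_0_iff)
  have "[geom m b = 1 + b] (mod r)" using c1 by (rule cong_dvd_modulus_nat) simp
  moreover have "[1 + b = 1 + 0] (mod r)" using r(2) by (intro cong_add) (simp_all add: cong_0_iff)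
  ultimately have "[x ^ (r ^ a) = 1] (mod r)" using eq yx cong_trans by simp
  then have "[x = 1] (mod r)" using fermat_cong_pow[OF r(1), of x a] by (simp add: cong_def)
  then have "[x ^ (r ^ a) = 1] (mod r ^ Suc a)" by (rule cong_power_prime_pow[OF r(1)])
  then have "[1 + b = 1] (mod r ^ Suc a)" using c1 eq yx by (simp add: cong_def)
  then have "[1 + b = 1 + 0] (mod r ^ Suc a)" by simp
  then have "r ^ Suc a dvd b" using cong_add_lcancel_nat cong_0_iff by blast
  with ra' show False by blast
qed

text \<open>First-order expansion in \<open>r * c\<close>; it shows that an odd prime divides \<open>geom \<rho> T\<close> at most once.\<close>

lemma geom_cong_linear:
  "[geom m (1 + r * c) = m + r * c * (\<Sum>i<m. i)] (mod r ^ 2)"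
proof -
  have "[(1 + r * c) ^ i = 1 + r * c * i] (mod r ^ 2)" for i
  proof (induction i)
    case (Suc i)
    have "[(1 + r * c) ^ Suc i = (1 + r * c) * (1 + r * c * i)] (mod r ^ 2)"
      using cong_mult[OF cong_refl[of "1 + r * c"] Suc] by (simp only: power_Suc)
    moreover have "(1 + r * c) * (1 + r * c * i) = 1 + r * c * Suc i + r ^ 2 * (c * c * i)"
      by (simp add: algebra_simps power2_eq_square)
    ultimately show ?case unfolding cong_def by (metis mod_mult_self2)
  qed simp
  then have "[geom m (1 + r * c) = (\<Sum>i<m. 1 + r * c * i)] (mod r ^ 2)"
    unfolding geom_def by (intro cong_sum) auto
  also have "(\<Sum>i<m. 1 + r * c * i) = m + r * c * (\<Sum>i<m. i)"
    by (simp only: sum.distrib sum_distrib_left[symmetric]) simp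
  finally show ?thesis .
qed

lemma not_square_dvd_geom:
  assumes p: "prime \<rho>" "odd \<rho>"
  shows "\<not> \<rho> ^ 2 dvd geom \<rho> T"
proof
  assume d: "\<rho> ^ 2 dvd geom \<rho> T"
  then have d1: "\<rho> dvd geom \<rho> T" by (metis dvd_mult_left power2_eq_square)
  have "T \<noteq> 0"
  proof
    assume "T = 0"
    moreover obtain k where "\<rho> = Suc k" using p(2) odd_pos gr0_implies_Suc by blast
    ultimately show False using d1 p(1) by (simp add: geom_Suc)
  qed
  then have "[T ^ \<rho> = 1] (mod \<rho>)" using geom_dvd_power_cong d1 by simp
  then have "[T = 1] (mod \<rho>)" using fermat_cong[OF p(1), of T] by (simp add: cong_def)
  then obtain c where c: "T = 1 + \<rho> * c"
    using \<open>T \<noteq> 0\<close> cong_altdef_nat[of 1 T \<rho>] cong_sym[of T 1 \<rho>]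
    by (metis One_nat_def Suc_leI add.commute dvdE le_add_diff_inverse2 neq0_conv)
  obtain h where h: "\<rho> = 2 * h + 1" using p(2) by (elim oddE)
  have "2 * (\<Sum>i<\<rho>. i) = \<rho> * (\<rho> - 1)" by (induction \<rho>) (auto simp: algebra_simps)
  then have "(\<Sum>i<\<rho>. i) = \<rho> * h" using h by simp
  then have "[geom \<rho> T = \<rho> + \<rho> ^ 2 * (c * h)] (mod \<rho> ^ 2)"
    using geom_cong_linear[of \<rho> \<rho> c] c by (simp add: power2_eq_square mult_ac)
  then have "[geom \<rho> T = \<rho>] (mod \<rho> ^ 2)" by (simp add: cong_def)
  then have "\<rho> ^ 2 dvd \<rho>" using d cong_dvd_iff by blast
  then have "\<rho> ^ 2 \<le> \<rho>" using prime_gt_0_nat[OF p(1)] by (rule dvd_imp_le)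
  then show False using prime_gt_1_nat[OF p(1)] by (simp add: power2_eq_square)
qed

text \<open>Lifting the exponent: each factor \<open>\<rho>\<close> of \<open>m\<close> splits off one \<open>geom \<rho> b\<close>, which contributes exactly one factor \<open>\<rho>\<close>.\<close>

lemma prime_power_dvd_geom:
  assumes p: "prime \<rho>" "odd \<rho>"
  shows "[b = 1] (mod \<rho>) \<Longrightarrow> \<rho> ^ n dvd geom m b \<Longrightarrow> \<rho> ^ n dvd m"
proof (induction n arbitrary: b m)
  case (Suc n)
  have "\<rho> dvd geom m b" using Suc.prems(2) by (metis dvd_mult_left power_Suc)
  then have "\<rho> dvd m" using geom_cong_one[OF Suc.prems(1)] cong_dvd_iff by blast
  then obtain k where k: "m = \<rho> * k" by blast
  have dv: "\<rho> * \<rho> ^ n dvd geom \<rho> b * geom k (b ^ \<rho>)" using Suc.prems(2) by (simp add: k geom_mult)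
  have "\<rho> dvd geom \<rho> b" using geom_cong_one[OF Suc.prems(1), of \<rho>] by (simp add: cong_dvd_iff)
  then obtain c where c: "geom \<rho> b = \<rho> * c" by blast
  have "\<not> \<rho> dvd c" using not_square_dvd_geom[OF p, of b] c by (auto simp: power2_eq_square)
  then have "coprime (\<rho> ^ n) c" using p(1) by (simp add: prime_imp_coprime)
  moreover have "\<rho> ^ n dvd c * geom k (b ^ \<rho>)" using dv c prime_gt_0_nat[OF p(1)] by (simp add: mult.assoc)
  ultimately have "\<rho> ^ n dvd geom k (b ^ \<rho>)" using coprime_dvd_mult_right_iff by blast
  moreover have "[b ^ \<rho> = 1] (mod \<rho>)" using cong_pow[OF Suc.prems(1), of \<rho>] by simp
  ultimately have "\<rho> ^ n dvd k" using Suc.IH by blast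
  then show ?case by (simp add: k)
qed simp

text \<open>The two lower bounds are what the size comparison between neighbouring factors needs. In the induction
\<open>geom (Suc r) T\<close> is at least \<open>T \<ge> 2\<close> times \<open>geom r T\<close>, while \<open>(r + 1)\<^sup>3 \<le> 2 r\<^sup>3\<close> only from \<open>r = 4\<close> on.\<close>

lemma geom_lower_cubic:
  assumes "r \<ge> 3" "T \<ge> 2" shows "r ^ 3 * (T - 1) \<le> 5 * geom r T"
  using assms(1)
proof (induction r rule: nat_induct_at_least)
  case base
  obtain t where t: "T = t + 2" using assms(2) by (metis add.commute le_Suc_ex)
  have "27 * (t + 1) \<le> 5 * (1 + (t + 2) + (t + 2)^2)"
  proof (cases "t \<le> 1")
    case True then show ?thesis by (cases t) (auto simp: power2_eq_square)
  next
    case False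
    then have "2 * t \<le> t * t" by simp
    then have "27 * t + 27 \<le> 5 * (t * t) + 25 * t + 35" by linarith
    then show ?thesis by (simp add: power2_eq_square algebra_simps)
  qed
  then show ?case by (simp add: t geom_Suc eval_nat_numeral algebra_simps)
next
  case (Suc r)
  show ?case
  proof (cases "r = 3")
    case True
    have "27 * (T - 1) * T \<le> 5 * geom 3 T * T" using Suc.IH True by (intro mult_right_mono) auto
    moreover have "64 * (T - 1) \<le> 5 * (1 + T * geom 3 T)"
    proof (cases "T = 2")
      case True then show ?thesis by (simp add: geom_Suc eval_nat_numeral)
    next
      case False
      then have "64 * (T - 1) \<le> T * (27 * (T - 1))"
        using assms(2) mult_le_mono1[of 3 T "27 * (T - 1)"] by simp
      with calculation show ?thesis by (simp add: algebra_simps)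
    qed
    moreover have "geom (Suc r) T = 1 + T * geom 3 T" using True geom_Suc[of 3 T] by simp
    ultimately show ?thesis using True by simp
  next
    case False
    then have r: "r \<ge> 4" using Suc.hyps by simp
    have "Suc r ^ 3 \<le> 2 * r ^ 3"
    proof -
      obtain s where s: "r = s + 4" using r by (metis add.commute le_Suc_ex)
      show ?thesis unfolding s by (simp add: eval_nat_numeral algebra_simps)
    qed
    then have "Suc r ^ 3 * (T - 1) \<le> 2 * (r ^ 3 * (T - 1))" by (metis mult.assoc mult_le_mono1)
    also have "\<dots> \<le> T * (5 * geom r T)" using mult_le_mono[OF assms(2) Suc.IH] .
    also have "\<dots> \<le> 5 * geom (Suc r) T" by (simp add: geom_Suc)
    finally show ?thesis .
  qed
qed

lemma geom_lower_square:
  assumes "r \<ge> 3" "T \<ge> 2" shows "r ^ 2 * (T - 1) \<le> 2 * geom r T"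
  using assms(1)
proof (induction r rule: nat_induct_at_least)
  case base
  obtain t where t: "T = t + 2" using assms(2) by (metis add.commute le_Suc_ex)
  have "9 * (t + 1) \<le> 2 * (1 + (t + 2) + (t + 2)^2)"
  proof -
    have "t \<le> t * t" by (cases t) auto
    then have "9 * t + 9 \<le> 2 * (t * t) + 10 * t + 14" by linarith
    then show ?thesis by (simp add: power2_eq_square algebra_simps)
  qed
  then show ?case by (simp add: t geom_Suc eval_nat_numeral algebra_simps)
next
  case (Suc r)
  have "Suc r ^ 2 \<le> 2 * r ^ 2"
  proof -
    obtain s where s: "r = s + 3" using Suc.hyps by (metis add.commute le_Suc_ex)
    show ?thesis unfolding s by (simp add: eval_nat_numeral algebra_simps)
  qed
  then have "Suc r ^ 2 * (T - 1) \<le> 2 * (r ^ 2 * (T - 1))" by (metis mult.assoc mult_le_mono1)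
  also have "\<dots> \<le> T * (2 * geom r T)" using mult_le_mono[OF assms(2) Suc.IH] .
  also have "\<dots> \<le> 2 * geom (Suc r) T" by (simp add: geom_Suc)
  finally show ?case .
qed

lemma le_two_power_pred: "T \<ge> 1 \<Longrightarrow> T \<le> 2 ^ (T - 1)"
  using less_exp[of "T - 1"] by linarith

lemma square_less_power_two: "t \<ge> 1 \<Longrightarrow> t ^ 2 < 2 ^ (t + 1)" for t :: nat
proof (induction t rule: nat_induct_at_least)
  case (Suc t)
  show ?case
  proof (cases "t < 3")
    case True
    then have "t = 1 \<or> t = 2" using Suc.hyps by auto
    then show ?thesis by (auto simp: eval_nat_numeral)
  next
    case False
    then obtain s where s: "t = s + 3" by (metis add.commute le_Suc_ex not_le)
    have "Suc t ^ 2 \<le> 2 * t ^ 2" unfolding s by (simp add: eval_nat_numeral algebra_simps)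
    with Suc show ?thesis by simp
  qed
qed simp

section \<open>Exponents divisible by the base\<close>

lemma not_coprime_imp_prime:
  assumes "\<not> coprime (a::nat) b"
  obtains r where "prime r" "r dvd a" "r dvd b"
proof -
  have "gcd a b \<noteq> 1" using assms coprime_iff_gcd_eq_1 by blast
  then obtain r where "prime r" "r dvd gcd a b" using prime_factor_nat by blast
  then show ?thesis using that by auto
qed

lemma coprime_mult_eq_mult_power:
  fixes A B c v n :: nat
  assumes cop: "coprime A B" and eq: "A * B = c * v ^ n" and pos: "A > 0" "B > 0" and n: "n > 0"
  obtains c1 c2 y z where "A = c1 * y ^ n" "B = c2 * z ^ n" "c = c1 * c2" "v = y * z"
proof -
  have "c dvd A * B" using eq by simp
  then obtain c1 c2 where c: "c = c1 * c2" "c1 dvd A" "c2 dvd B" using division_decomp by blast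
  then obtain A' B' where AB: "A = c1 * A'" "B = c2 * B'" by blast
  have "c1 * c2 * (A' * B') = c1 * c2 * v ^ n" using eq by (simp add: c AB mult_ac)
  then have v: "A' * B' = v ^ n" using pos AB by simp
  have "coprime A' B'" using cop AB by simp
  moreover have "is_nth_power n (A' * B')" unfolding v by simp
  moreover have "A' > 0" "B' > 0" using pos AB by auto
  ultimately obtain y z where yz: "A' = y ^ n" "B' = z ^ n"
    using is_nth_power_mult_coprime_natD unfolding is_nth_power_def by metis
  have "(y * z) ^ n = v ^ n" using v yz by (simp add: power_mult_distrib)
  then have "v = y * z" using n by (metis power_eq_iff_eq_base le0)
  with c AB yz that show ?thesis by blast
qed

text \<open>\<open>P k\<close> below says that \<open>\<rho>\<close> is the only prime that \<open>v\<close> can share with \<open>A k = geom \<rho> (b ^ k)\<close>. It is proved for all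
\<open>k\<close> with \<open>k * \<rho> dvd m\<close> by adding one prime factor to \<open>k\<close> at a time. If \<open>P k\<close> holds, then \<open>A k\<close> without its possible factor
\<open>\<rho>\<close> is coprime to \<open>v\<close> and divides \<open>n2\<close>. Thus \<open>n\<close> is at least about \<open>b * A k / \<rho>\<close>, an exponential in \<open>k\<close>, while a
failure of \<open>P\<close> at the next stage would need a prime power \<open>p ^ n\<close> below \<open>b ^ (k * \<rho>\<^sup>2)\<close>. The
bound on \<open>v\<close> settles the case that \<open>\<rho>\<close> divides both \<open>b - 1\<close> and \<open>v\<close>.\<close>

theorem no_solution_b_dvd_n:
  fixes b m n2 v :: nat
  assumes b: "b \<ge> 2" and m: "m \<ge> 2" and v: "v \<ge> 2" "v \<le> 8896"
    and eq: "n2 * v ^ (b * n2) = geom m b"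
  shows False
proof -
  define n where "n = b * n2"
  define \<rho> where "\<rho> = Max (prime_factors m)"
  have fin: "finite (prime_factors m)" "prime_factors m \<noteq> {}"
    using m prime_factor_nat[of m] by (auto simp: prime_factors_dvd)
  have \<rho>: "prime \<rho>" "\<rho> dvd m"
    using Max_in[OF fin] unfolding \<rho>_def by (auto simp: prime_factors_dvd)
  have \<rho>max: "q \<le> \<rho>" if "prime q" "q dvd m" for q
    using that m Max_ge[OF fin(1), of q] unfolding \<rho>_def by (auto simp: prime_factors_dvd)
  have \<rho>2: "\<rho> \<ge> 2" using \<rho>(1) prime_ge_2_nat by blast
  have eq: "n2 * v ^ n = geom m b" using eq by (simp add: n_def)
  have "n2 \<noteq> 0" using eq geom_pos[of m b] m by (metis gr_implies_not_zero mult_0 neq0_conv not_numeral_le_zero)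
  moreover have "n2 \<noteq> 1" using geom_not_power[OF b m, of n v] eq by (auto simp: n_def)
  ultimately have n2: "n2 \<ge> 2" by simp
  have n_b: "n \<ge> 2 * b" using n2 by (simp add: n_def)
  define A where "A k = geom \<rho> (b ^ k)" for k
  have A_pos: "A k > 0" for k unfolding A_def using \<rho>2 by (intro geom_pos) simp
  have split: "\<exists>B. geom m b = A k * B \<and> (\<forall>p. prime p \<longrightarrow> p dvd A k \<longrightarrow> p dvd B \<longrightarrow> p = \<rho>)"
    if k: "k * \<rho> dvd m" for k
  proof -
    obtain t where t: "m = k * \<rho> * t" using k by blast
    then have t0: "t > 0" using m by (cases t) auto
    have "geom m b = A k * (geom k b * geom t (b ^ (k * \<rho>)))"
      unfolding t geom_mult A_def by (simp only: mult_ac)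
    moreover have "p = \<rho>" if "prime p" "p dvd A k" "p dvd geom k b * geom t (b ^ (k * \<rho>))" for p
      using that t0 \<rho>max b t by (intro prime_dvd_cofactor[OF that(1) \<rho>(1), of b t k]) (auto simp: A_def)
    ultimately show ?thesis by blast
  qed
  define P where "P k \<longleftrightarrow> (\<forall>p. prime p \<longrightarrow> p dvd v \<longrightarrow> p dvd A k \<longrightarrow> p = \<rho>)" for k
  have notP: "\<exists>p. prime p \<and> p \<noteq> \<rho> \<and> \<rho> dvd p - 1 \<and> p > \<rho> \<and> p ^ n \<le> A k"
    if k: "k * \<rho> dvd m" and np: "\<not> P k" for k
  proof -
    obtain p where p: "prime p" "p dvd v" "p dvd A k" "p \<noteq> \<rho>" using np unfolding P_def by blast
    obtain B where B: "geom m b = A k * B" "\<And>p. prime p \<Longrightarrow> p dvd A k \<Longrightarrow> p dvd B \<Longrightarrow> p = \<rho>"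
      using split[OF k] by blast
    have "p ^ n dvd A k * B"
      using p(2) eq B(1) by (metis dvd_mult dvd_power_same)
    moreover have "\<not> p dvd B" using B(2) p by blast
    then have "coprime (p ^ n) B" using p(1) by (simp add: prime_imp_coprime)
    ultimately have "p ^ n dvd A k" using coprime_dvd_mult_left_iff by blast
    then have "p ^ n \<le> A k" using A_pos by (rule dvd_imp_le)
    moreover have d: "\<rho> dvd p - 1"
      using prime_dvd_geom_prime[OF p(1) \<rho>(1), of "b ^ k"] p b by (auto simp: A_def)
    moreover have "p > \<rho>" using d p(1) prime_gt_1_nat[OF p(1)] dvd_imp_le[OF d] by linarith
    ultimately show ?thesis using p by blast
  qed
  have b2: "b < 2 ^ b" by (rule less_exp)
  \<comment> \<open>If \<open>p ^ n\<close> divides \<open>A 1 < b ^ \<rho>\<close>, then \<open>n2 < \<rho>\<close>; the primes of \<open>A 1\<close> are at least \<open>\<rho>\<close>, so none of them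
    divides \<open>n2\<close>, and \<open>A 1\<close> is an \<open>n\<close>-th power unless \<open>\<rho>\<close> intervenes.\<close>
  have P1: "P 1"
  proof (rule ccontr)
    assume "\<not> P 1"
    with notP[of 1] \<rho> obtain p where p: "prime p" "p > \<rho>" "p ^ n \<le> A 1" by auto
    have "A 1 < b ^ \<rho>" using geom_less[OF b, of \<rho>] by (simp add: A_def)
    with p(3) have pn: "p ^ n < b ^ \<rho>" by linarith
    have n2r: "n2 < \<rho>"
    proof (rule ccontr)
      assume "\<not> n2 < \<rho>"
      then have "b * \<rho> \<le> n" unfolding n_def by simp
      have "b ^ \<rho> \<le> (2 ^ b) ^ \<rho>" using b2 by (intro power_mono) auto
      also have "\<dots> = 2 ^ (b * \<rho>)" by (simp add: power_mult)
      also have "\<dots> \<le> 2 ^ n" using \<open>b * \<rho> \<le> n\<close> by (intro power_increasing) auto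
      also have "\<dots> \<le> p ^ n" using prime_ge_2_nat[OF p(1)] by (intro power_mono) auto
      finally show False using pn by simp
    qed
    have nd: "\<not> r dvd n2" if "r \<ge> \<rho>" for r
      using that n2r n2 dvd_imp_le[of r n2] by auto
    obtain B where B: "geom m b = A 1 * B" "\<And>p. prime p \<Longrightarrow> p dvd A 1 \<Longrightarrow> p dvd B \<Longrightarrow> p = \<rho>"
      using split[of 1] \<rho>(2) by auto
    have A1: "A 1 = geom \<rho> b" "A (Suc 0) = geom \<rho> b" by (simp_all add: A_def)
    have big: "r \<ge> \<rho>" if "prime r" "r dvd A 1" for r
    proof (cases "r = \<rho>")
      case False
      then have "\<rho> dvd r - 1" using prime_dvd_geom_prime[OF that(1) \<rho>(1), of b] that b by (auto simp: A1)
      then show ?thesis using prime_gt_1_nat[OF that(1)] dvd_imp_le[of \<rho> "r - 1"] by linarith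
    qed simp
    have cop: "coprime (A 1) n2"
    proof (rule ccontr)
      assume "\<not> coprime (A 1) n2"
      then obtain r where "prime r" "r dvd A 1" "r dvd n2"
          using not_coprime_imp_prime by blast
      then show False using big nd by blast
    qed
    show False
    proof (cases "\<rho> dvd A 1")
      case False
      have "coprime (A 1) B"
      proof (rule ccontr)
        assume "\<not> coprime (A 1) B"
        then obtain r where "prime r" "r dvd A 1" "r dvd B"
          using not_coprime_imp_prime by blast
        then show False using B(2) False by blast
      qed
      moreover have "B > 0" using B(1) geom_pos[of m b] m by (cases B) auto
      moreover have "A 1 * B = n2 * v ^ n" using eq B(1) by simp
      ultimately obtain c1 c2 y where c: "A 1 = c1 * y ^ n" "n2 = c1 * c2"
        using coprime_mult_eq_mult_power[of "A 1" B n2 v n] A_pos n_b b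
        by (metis gr0I mult_is_0 not_numeral_le_zero le_zero_eq)
      have "c1 = 1" using cop c by (metis coprime_mult_left_iff coprime_mult_right_iff coprime_self nat_dvd_1_iff_1)
      then have "A 1 = y ^ n" using c by simp
      then show False using geom_not_power[OF b \<rho>2, of n y] A1 by (simp add: n_def)
    next
      case True
      show False
      proof (cases "odd \<rho>")
        case False
        then have "\<rho> = 2" using primes_dvd_imp_eq[OF two_is_prime_nat \<rho>(1)] by simp
        \<comment> \<open>For \<open>\<rho> = 2\<close> the factor \<open>A 1 = b + 1\<close> is too small to contain an \<open>n\<close>-th power.\<close>
        then have "p ^ n \<le> 1 + b" using p(3) A1 geom_2 by simp
        moreover have "2 ^ n \<le> p ^ n" using prime_ge_2_nat[OF p(1)] by (intro power_mono) auto
        moreover have "2 * b \<le> n" by (rule n_b)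
        moreover have "n < 2 ^ n" by (rule less_exp)
        ultimately show False using b by linarith
      next
        case od: True
        have "[b ^ \<rho> = 1] (mod \<rho>)" using geom_dvd_power_cong[of b \<rho> \<rho>] True b A1 by simp
        then have b1: "[b = 1] (mod \<rho>)" using fermat_cong[OF \<rho>(1), of b] by (simp add: cong_def)
        have \<rho>3: "\<rho> \<ge> 3" using od \<rho>2 by (cases "\<rho> = 2") auto
        have "\<rho> dvd b - 1" using b1 b cong_altdef_nat[of 1 b \<rho>] cong_sym by auto
        then have b4: "b \<ge> 4" using b \<rho>3 dvd_imp_le[of \<rho> "b - 1"] by linarith
        have "\<rho> dvd n2 * v ^ n" using True eq B(1) by simp
        then have "\<rho> dvd v" using nd[of \<rho>] \<rho>(1) by (metis order_refl prime_dvd_mult_iff prime_dvd_power)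
        then have "\<rho> ^ n dvd geom m b" using eq by (metis dvd_mult dvd_power_same)
        \<comment> \<open>Now \<open>m\<close> is at least \<open>3 ^ n\<close>, and \<open>geom m b\<close> is doubly exponential in \<open>n\<close>, unlike \<open>n2 * v ^ n\<close>.\<close>
        then have "\<rho> ^ n dvd m" using prime_power_dvd_geom[OF \<rho>(1) od b1] by blast
        then have "\<rho> ^ n \<le> m" using m by (intro dvd_imp_le) auto
        moreover have "3 ^ n \<le> \<rho> ^ n" using \<rho>3 by (intro power_mono) auto
        ultimately have m3: "3 ^ n \<le> m" by linarith
        have "4 ^ (3 ^ n - 1) \<le> b ^ (m - 1)"
          using b4 m3 by (intro order.trans[OF power_mono power_increasing]) auto
        also have "\<dots> \<le> geom m b" using geom_ge_power[where m = "m - 1" and b = b] m by simp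
        also have "\<dots> \<le> n * 8896 ^ n" unfolding eq[symmetric] n_def
          using v b by (intro mult_mono power_mono) auto
        also have "\<dots> \<le> 2 ^ n * (2 ^ 14) ^ n"
          using less_exp[of n] by (intro mult_mono power_mono) auto
        also have "\<dots> = (2 ^ 15) ^ n" by (simp add: power_mult_distrib[symmetric])
        also have "\<dots> = 2 ^ (15 * n)" by (rule power_mult[symmetric])
        finally have "2 ^ (2 * (3 ^ n - 1)) \<le> (2::nat) ^ (15 * n)" by (simp add: power_mult)
        then have "2 * (3 ^ n - 1) \<le> 15 * n" by (simp add: power_increasing_iff)
        moreover have "15 * n + 2 < 2 * 3 ^ n" if "n \<ge> 4"
          using that by (induction n rule: nat_induct_at_least) auto
        moreover have "n \<ge> 4" using n_b b4 by linarith
        ultimately show False by linarith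
      qed
    qed
  qed
  have dvd_n2: "A k \<le> \<rho> * n2" if k: "k * \<rho> dvd m" "P k" "\<not> \<rho> ^ 2 dvd A k" for k
  proof -
    obtain c where c: "A k = c \<or> A k = \<rho> * c" "\<not> \<rho> dvd c" "c dvd A k"
    proof (cases "\<rho> dvd A k")
      case True
      then obtain c where c: "A k = \<rho> * c" by blast
      then have "\<not> \<rho> dvd c" using k(3) by (auto simp: power2_eq_square)
      with c show ?thesis using that[of c] by simp
    qed (use that[of "A k"] in auto)
    have "coprime c v"
    proof (rule ccontr)
      assume "\<not> coprime c v"
      then obtain r where r: "prime r" "r dvd c" "r dvd v"
          using not_coprime_imp_prime by blast
      then have "r dvd A k" using c(3) dvd_trans by blast
      then have "r = \<rho>" using k(2) r unfolding P_def by blast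
      then show False using r c(2) by simp
    qed
    then have "coprime c (v ^ n)" by simp
    moreover have "c dvd n2 * v ^ n" using split[OF k(1)] eq c(3) by (metis dvd_mult2)
    ultimately have "c dvd n2" using coprime_dvd_mult_left_iff by blast
    then have "c \<le> n2" using n2 by (intro dvd_imp_le) auto
    moreover have "1 * c \<le> \<rho> * c" using \<rho>2 by (intro mult_right_mono) auto
    ultimately have "A k \<le> \<rho> * c" using c(1) by auto
    also have "\<dots> \<le> \<rho> * n2" using \<open>c \<le> n2\<close> by simp
    finally show ?thesis .
  qed
  have lo_odd: "2 * A k \<le> \<rho> * n" if "k * \<rho> dvd m" "P k" "odd \<rho>" for k
  proof -
    have "A k \<le> \<rho> * n2" using dvd_n2[OF that(1,2)] not_square_dvd_geom[OF \<rho>(1) that(3)] by (simp add: A_def)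
    then have "b * A k \<le> b * (\<rho> * n2)" by simp
    moreover have "2 * A k \<le> b * A k" using b by simp
    ultimately have "2 * A k \<le> b * (\<rho> * n2)" by linarith
    then show ?thesis by (simp only: n_def mult_ac)
  qed
  have lo_two: "b ^ k + 1 \<le> n" if k: "k * \<rho> dvd m" "P k" "\<rho> = 2" "k > 0" for k
  proof (cases "k = 1")
    case True then show ?thesis using n_b b by simp
  next
    case False
    then obtain q where q: "prime q" "q dvd k" using prime_factor_nat by blast
    then have "q dvd m" using k(1) by (meson dvd_trans dvd_triv_left)
    then have "q = 2" using \<rho>max[OF q(1)] k(3) prime_ge_2_nat[OF q(1)] by simp
    then obtain h where h: "k = 2 * h" using q by blast
    \<comment> \<open>For even \<open>k\<close> the factor \<open>A k\<close> is a square plus one, so it is not divisible by \<open>4\<close>.\<close>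
    have Ak: "A k = (b ^ h) ^ 2 + 1" by (simp add: A_def k(3) geom_2 h power_mult[symmetric] mult.commute)
    have "\<not> 4 dvd x ^ 2 + 1" for x :: nat
    proof
      assume "4 dvd x ^ 2 + 1"
      moreover have "x ^ 2 mod 4 = (x mod 4) ^ 2 mod 4" by (simp add: power_mod)
      moreover have "x mod 4 = 0 \<or> x mod 4 = 1 \<or> x mod 4 = 2 \<or> x mod 4 = 3" by presburger
      ultimately have "x ^ 2 mod 4 = 0 \<or> x ^ 2 mod 4 = 1" by auto
      with \<open>4 dvd x ^ 2 + 1\<close> show False by presburger
    qed
    then have "A k \<le> 2 * n2" using dvd_n2[OF k(1,2)] k(3) Ak by simp
    also have "\<dots> \<le> n" using b by (simp add: n_def)
    finally show ?thesis by (simp add: A_def k(3) geom_2)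
  qed
  have two_pow: "(T::nat) ^ j \<le> 2 ^ ((T - 1) * j)" if "T \<ge> 1" for T j
    using power_mono[OF le_two_power_pred[OF that], of j] by (simp add: power_mult)
  have step: "P (k * l)" if k: "k * l * \<rho> dvd m" "P k" "prime l" "k > 0" for k l
  proof (rule ccontr)
    assume "\<not> P (k * l)"
    with notP[OF k(1)] obtain p where p: "prime p" "p > \<rho>" "\<rho> dvd p - 1" "p ^ n \<le> A (k * l)" by blast
    have kd: "k * \<rho> dvd m" using k(1) by (metis dvd_mult_left mult.assoc mult.commute)
    have "l dvd m" using k(1) by (metis dvd_mult_left dvd_mult_right mult.commute)
    then have l: "l \<le> \<rho>" using \<rho>max k(3) by blast
    define T where "T = b ^ k"
    have "b ^ 1 \<le> b ^ k" using b k(4) by (intro power_increasing) auto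
    then have T: "T \<ge> 2" using b unfolding T_def by simp
    have "A (k * l) < (b ^ (k * l)) ^ \<rho>" unfolding A_def
      using geom_less[of "b ^ (k * l)"] T power_increasing[of 1 l T] prime_gt_0_nat[OF k(3)]
      by (simp add: T_def power_mult)
    then have pT: "p ^ n < T ^ (l * \<rho>)" using p(4) by (simp add: T_def power_mult)
    show False
    proof (cases "odd \<rho>")
      case True
      have \<rho>3: "\<rho> \<ge> 3" using True \<rho>2 by (cases "\<rho> = 2") auto
      have "odd p" using p(1,2) \<rho>2 prime_odd_nat[of p] by linarith
      obtain j where j: "p - 1 = \<rho> * j" using p(3) by blast
      have "even (p - 1)" using \<open>odd p\<close> by simp
      then have "even (\<rho> * j)" unfolding j .
      then have "even j" using True by simp
      moreover have "j \<noteq> 0" using j prime_gt_1_nat[OF p(1)] by (cases j) auto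
      ultimately have "j \<ge> 2" by (cases "j = 1") auto
      then have "2 * \<rho> \<le> p - 1" using j by simp
      \<comment> \<open>Using \<open>p\<^sup>2 \<ge> 2 ^ 5\<close>, which is where \<open>p \<ge> 7\<close> instead of \<open>p > \<rho>\<close> is needed for \<open>\<rho> = 3\<close>.\<close>
      then have p7: "p \<ge> 7" using \<rho>3 by linarith
      have "2 ^ (5 * A k) = (32::nat) ^ A k" by (simp add: power_mult)
      also have "\<dots> \<le> (p ^ 2) ^ A k"
        using power_mono[OF p7, of 2] by (intro power_mono) auto
      also have "\<dots> = p ^ (2 * A k)" by (simp add: power_mult)
      also have "\<dots> \<le> p ^ (\<rho> * n)"
        using lo_odd[OF kd k(2) True] p7 by (intro power_increasing) auto
      also have "\<dots> = (p ^ n) ^ \<rho>" by (simp add: power_mult[symmetric] mult.commute)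
      also have "\<dots> < (T ^ (l * \<rho>)) ^ \<rho>" using pT \<rho>2 by (intro power_strict_mono) auto
      also have "\<dots> = T ^ (l * \<rho> ^ 2)" by (simp add: power_mult[symmetric] power2_eq_square mult.assoc)
      also have "\<dots> \<le> T ^ (\<rho> ^ 3)"
        using l T by (intro power_increasing) (auto simp: power2_eq_square power3_eq_cube)
      also have "\<dots> \<le> 2 ^ ((T - 1) * \<rho> ^ 3)" using T by (intro two_pow) auto
      finally have "5 * A k < (T - 1) * \<rho> ^ 3" by (simp add: power_strict_increasing_iff)
      then show False using geom_lower_cubic[OF \<rho>3 T] by (simp add: A_def T_def mult.commute)
    next
      case False
      then have r: "\<rho> = 2" using primes_dvd_imp_eq[OF two_is_prime_nat \<rho>(1)] by simp
      then have "l = 2" using l prime_ge_2_nat[OF k(3)] by simp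
      then have "p ^ n \<le> T ^ 2 + 1" using p(4) r by (simp add: A_def geom_2 T_def power_mult)
      moreover have "2 ^ (T + 1) \<le> p ^ n"
        using lo_two[OF kd k(2) r k(4)] prime_ge_2_nat[OF p(1)] unfolding T_def
        by (intro order.trans[OF power_mono power_increasing]) auto
      moreover have "T ^ 2 < 2 ^ (T + 1)" using T by (intro square_less_power_two) auto
      moreover have "3 ^ (T + 1) \<le> p ^ n"
        using lo_two[OF kd k(2) r k(4)] p(2) r unfolding T_def
        by (intro order.trans[OF power_mono power_increasing]) auto
      moreover have "2 ^ (T + 1) < (3::nat) ^ (T + 1)" by (intro power_strict_mono) auto
      ultimately show False by linarith
    qed
  qed
  have all: "P k" if "k * \<rho> dvd m" "k > 0" for k
    using that
  proof (induction k rule: less_induct)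
    case (less k)
    show ?case
    proof (cases "k = 1")
      case False
      then obtain l where l: "prime l" "l dvd k" using prime_factor_nat by blast
      then obtain j where j: "k = j * l" by (metis dvd_def mult.commute)
      have "j > 0" using j less.prems(2) by (cases j) auto
      moreover have "j < k" using j prime_gt_1_nat[OF l(1)] \<open>j > 0\<close> by simp
      moreover have "j * \<rho> dvd m" using less.prems(1) j by (metis dvd_mult_left mult.assoc mult.commute)
      ultimately have "P j" using less.IH by blast
      then show ?thesis using step[of j l] less.prems l j \<open>j > 0\<close> by simp
    qed (use P1 in simp)
  qed
  obtain k where k: "m = k * \<rho>" using \<rho>(2) by (metis dvd_def mult.commute)
  have k0: "k > 0" using k m by (cases k) auto
  have Pk: "P k" using all k k0 by simp
  define T where "T = b ^ k"
  have "b ^ 1 \<le> b ^ k" using b k0 by (intro power_increasing) auto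
  then have T: "T \<ge> 2" using b unfolding T_def by simp
  have "2 ^ n \<le> v ^ n" using v by (intro power_mono) auto
  also have "\<dots> \<le> geom m b" using eq n2 by (metis mult_le_mono1 nat_mult_1 le_trans one_le_numeral)
  also have "\<dots> < T ^ \<rho>" using geom_less[OF b, of m] by (simp add: k T_def power_mult)
  finally have vT: "2 ^ n < T ^ \<rho>" .
  show False
  proof (cases "odd \<rho>")
    case True
    have \<rho>3: "\<rho> \<ge> 3" using True \<rho>2 by (cases "\<rho> = 2") auto
    have "2 ^ (2 * A k) \<le> (2::nat) ^ (\<rho> * n)"
      using lo_odd[OF _ Pk True] k by (intro power_increasing) auto
    also have "\<dots> = (2 ^ n) ^ \<rho>" by (simp add: power_mult[symmetric] mult.commute)
    also have "\<dots> < (T ^ \<rho>) ^ \<rho>" using vT \<rho>2 by (intro power_strict_mono) auto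
    also have "\<dots> = T ^ (\<rho> ^ 2)" by (simp add: power_mult[symmetric] power2_eq_square)
    also have "\<dots> \<le> 2 ^ ((T - 1) * \<rho> ^ 2)" using T by (intro two_pow) auto
    finally have "2 * A k < (T - 1) * \<rho> ^ 2" by (simp add: power_strict_increasing_iff)
    then show False using geom_lower_square[OF \<rho>3 T] by (simp add: A_def T_def mult.commute)
  next
    case False
    then have r: "\<rho> = 2" using primes_dvd_imp_eq[OF two_is_prime_nat \<rho>(1)] by simp
    have "2 ^ (T + 1) \<le> (2::nat) ^ n"
      using lo_two[OF _ Pk r k0] k unfolding T_def by (intro power_increasing) auto
    moreover have "T ^ 2 < 2 ^ (T + 1)" using T by (intro square_less_power_two) auto
    moreover have "2 ^ n < T ^ 2" using vT r by simp
    ultimately show False by linarith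
  qed
qed

section \<open>Bounding the exponent by the two bases\<close>

text \<open>The first term of the series of \<open>ln\<close> in \<open>(x - 1) / (x + 1)\<close>; it keeps the bounds on \<open>n\<close> sharp also when the two bases are far apart.\<close>

lemma ln_ge_mean: "x \<ge> 1 \<Longrightarrow> 2 * (x - 1) / (x + 1) \<le> ln x" for x :: real
proof -
  assume x: "x \<ge> 1"
  have "ln 1 - 2 * (1 - 1) / (1 + 1) \<le> ln x - 2 * (x - 1) / (x + (1::real))"
  proof (rule DERIV_nonneg_imp_nondecreasing[OF x])
    fix t :: real assume t: "1 \<le> t" "t \<le> x"
    have "((\<lambda>t. ln t - 2 * (t - 1) / (t + 1)) has_real_derivative
        (1 / t - (2 * (t + 1) - 2 * (t - 1)) / (t + 1)^2)) (at t)"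
      using t by (auto intro!: derivative_eq_intros simp: power2_eq_square)
    moreover have "1 / t - (2 * (t + 1) - 2 * (t - 1)) / (t + 1)^2 = (t - 1)^2 / (t * (t + 1)^2)"
      using t by (simp add: divide_simps) (simp add: power2_eq_square algebra_simps)
    ultimately show "\<exists>y. ((\<lambda>t. ln t - 2 * (t - 1) / (t + 1)) has_real_derivative y) (at t) \<and> 0 \<le> y"
      using t by auto
  qed
  then show ?thesis by simp
qed

lemma ln2_upper: "ln 2 \<le> (25 / 36 :: real)"
proof -
  \<comment> \<open>Eight copies of the quadratic Taylor bound at \<open>25/288\<close> just suffice.\<close>
  have "(2::real) \<le> (1 + 25 / 288 + (25 / 288)^2 / 2) ^ 8" by (simp add: power2_eq_square power_divide)
  also have "\<dots> \<le> exp (25 / 288) ^ 8"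
    by (intro power_mono exp_lower_Taylor_quadratic) auto
  also have "\<dots> = exp (25 / 36 :: real)" using exp_of_nat_mult[of 8 "25 / 288 :: real"] by simp
  finally have "ln 2 \<le> ln (exp (25 / 36 :: real))" by (intro ln_mono) auto
  then show ?thesis by simp
qed

lemma ln_le_dyadic: "x > 0 \<Longrightarrow> ln x \<le> x / 2 ^ j + real j * (25 / 36) - 1" for x :: real
proof -
  assume x: "x > 0"
  have "ln x = ln (x / 2 ^ j) + real j * ln 2"
    using x by (simp add: ln_div ln_realpow)
  also have "ln (x / 2 ^ j) \<le> x / 2 ^ j - 1" using x by (intro ln_le_minus_one) simp
  also have "real j * ln 2 \<le> real j * (25 / 36)" by (intro mult_left_mono ln2_upper) auto
  finally show ?thesis by simp
qed

text \<open>The hypothesis says \<open>(g1 / g0) ^ n \<le> (8/7) (f n) ^ E\<close>. Taking logarithms, \<open>n\<close> times \<open>2 (g1 - g0) / (g1 + g0)\<close> is at most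
\<open>E ln (f n) + 1/7\<close>. The tangent of \<open>ln\<close> at \<open>2 ^ j\<close> makes the right-hand side linear in \<open>n\<close>, and the condition on \<open>j\<close> makes
its slope at most a quarter of the left-hand one.\<close>

lemma exponent_bound:
  fixes g1 g0 n f E j :: nat
  assumes g: "0 < g0" "g0 < g1" and n: "n \<ge> 1" "f \<ge> 1"
    and ineq: "7 * g1 ^ n \<le> 8 * (f * n) ^ E * g0 ^ n"
    and j: "2 * E * f * (g1 + g0) \<le> 2 ^ j * (g1 - g0)"
  shows "54 * int (g1 - g0) * int n \<le> int (g1 + g0) * (int E * (25 * int j - 36) + 6)"
proof -
  define d where "d = real (g1 - g0)"
  define \<sigma> where "\<sigma> = real (g1 + g0)"
  have d: "d > 0" "d = real g1 - real g0" and \<sigma>: "\<sigma> > 0" "\<sigma> = real g1 + real g0"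
    using g by (auto simp: d_def \<sigma>_def of_nat_diff)
  define q where "q = real g1 / real g0"
  have q: "q \<ge> 1" using g by (simp add: q_def)
  have "2 * d / \<sigma> = 2 * (q - 1) / (q + 1)"
    using g by (simp add: q_def d(2) \<sigma>(2) divide_simps)
  also have "\<dots> \<le> ln q" using q by (rule ln_ge_mean)
  finally have 1: "2 * d / \<sigma> \<le> ln q" .
  define N where "N = f * n"
  have fn: "real N > 0" using n by (simp add: N_def)
  have "real (7 * g1 ^ n) \<le> real (8 * N ^ E * g0 ^ n)"
    using ineq unfolding N_def by (rule of_nat_mono)
  then have "7 * real g1 ^ n \<le> 8 * real N ^ E * real g0 ^ n" by simp
  then have "q ^ n \<le> 8 / 7 * real N ^ E"
    using g by (simp add: q_def power_divide divide_simps mult_ac)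
  then have "ln (q ^ n) \<le> ln (8 / 7 * real N ^ E)"
    using q by (intro ln_mono) auto
  also have "\<dots> = ln (8 / 7) + real E * ln (real N)"
    using fn by (subst ln_mult) (auto simp: ln_realpow)
  also have "ln (8 / 7 :: real) \<le> 8 / 7 - 1" by (rule ln_le_minus_one) simp
  also have "ln (real N) \<le> real N / 2 ^ j + real j * (25 / 36) - 1"
    using fn by (rule ln_le_dyadic)
  finally have "real n * ln q \<le> 1 / 7 + real E * (real N / 2 ^ j + real j * (25 / 36) - 1)"
    using q by (simp add: ln_realpow mult_left_mono)
  moreover have "real n * (2 * d / \<sigma>) \<le> real n * ln q" using 1 by (intro mult_left_mono) auto
  moreover have "real E * (real N / 2 ^ j) \<le> real n * (d / (2 * \<sigma>))"
  proof -
    have "real (2 * E * f * (g1 + g0)) \<le> real (2 ^ j * (g1 - g0))" using j by (rule of_nat_mono)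
    then have "2 * real E * real f * \<sigma> \<le> 2 ^ j * d" by (simp add: d_def \<sigma>_def)
    then have "real E * real f / 2 ^ j \<le> d / (2 * \<sigma>)"
      using \<sigma>(1) by (simp add: divide_simps mult_ac)
    then have "real n * (real E * real f / 2 ^ j) \<le> real n * (d / (2 * \<sigma>))"
      by (intro mult_left_mono) auto
    then show ?thesis by (simp add: N_def mult_ac)
  qed
  ultimately have "real n * (2 * d / \<sigma>) \<le> 1 / 7 + real n * (d / (2 * \<sigma>)) + real E * (real j * (25 / 36) - 1)"
    by (simp add: algebra_simps)
  then have "real n * (3 / 2 * d / \<sigma>) \<le> 1 / 7 + real E * (real j * (25 / 36) - 1)"
    by (simp add: algebra_simps)
  then have "real n * (3 / 2 * d / \<sigma>) * (36 * \<sigma>) \<le> (1 / 7 + real E * (real j * (25 / 36) - 1)) * (36 * \<sigma>)"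
    using \<sigma>(1) by (intro mult_right_mono) auto
  then have "54 * d * real n \<le> \<sigma> * (real E * (25 * real j - 36) + 36 / 7)"
    using \<sigma>(1) by (simp add: algebra_simps)
  also have "\<dots> \<le> \<sigma> * (real E * (25 * real j - 36) + 6)"
    using \<sigma>(1) by (intro mult_left_mono) auto
  finally have "real_of_int (54 * int (g1 - g0) * int n) \<le> real_of_int (int (g1 + g0) * (int E * (25 * int j - 36) + 6))"
    by (simp add: d_def \<sigma>_def)
  then show ?thesis by (simp only: of_int_le_iff)
qed

lemma cube_le_three_power: "n \<ge> 3 \<Longrightarrow> n ^ 3 \<le> (3::nat) ^ n"
proof (induction n rule: nat_induct_at_least)
  case (Suc n)
  obtain s where s: "n = s + 3" using Suc.hyps by (metis add.commute le_Suc_ex)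
  have "Suc n ^ 3 \<le> 3 * n ^ 3" unfolding s by (simp add: eval_nat_numeral algebra_simps)
  with Suc show ?case by simp
qed simp

text \<open>The function \<open>n ^ (1 / n)\<close> decreases from \<open>n = 3\<close> on, so the case \<open>n = 3\<close> gives the weakest restriction on \<open>y / w\<close>.
The same holds for the reversed ratio in the next lemma.\<close>

lemma ratio_bound_above:
  fixes y w n D :: nat
  assumes n: "n \<ge> 3" and w: "w > 0" and ineq: "7 * y ^ n < 8 * n ^ D * w ^ n"
  shows "7 * y ^ 3 < 8 * 3 ^ D * w ^ 3"
proof (rule ccontr)
  assume "\<not> ?thesis"
  then have "(8 * 3 ^ D * w ^ 3) ^ n \<le> (7 * y ^ 3) ^ n" by (intro power_mono) auto
  then have a: "8 ^ n * (3 ^ n) ^ D * (w ^ n) ^ 3 \<le> 7 ^ n * (y ^ n) ^ 3"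
    by (simp add: power_mult_distrib power_mult[symmetric] mult.commute)
  have "(n ^ 3) ^ D \<le> (3 ^ n) ^ D" using cube_le_three_power[OF n] by (intro power_mono) auto
  have "(7 * y ^ n) ^ 3 < (8 * n ^ D * w ^ n) ^ 3" using ineq by (intro power_strict_mono) auto
  then have "7 ^ 3 * (y ^ n) ^ 3 < 8 ^ 3 * (n ^ 3) ^ D * (w ^ n) ^ 3"
    by (simp add: power_mult_distrib power_mult[symmetric] mult.commute)
  also have "\<dots> \<le> 8 ^ 3 * (3 ^ n) ^ D * (w ^ n) ^ 3"
    using \<open>(n ^ 3) ^ D \<le> (3 ^ n) ^ D\<close> by (intro mult_mono) auto
  finally have b: "7 ^ 3 * (y ^ n) ^ 3 < 8 ^ 3 * (3 ^ n) ^ D * (w ^ n) ^ 3" .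
  obtain s where s: "n = s + 3" using n by (metis add.commute le_Suc_ex)
  have "7 ^ n * (y ^ n) ^ 3 = 7 ^ s * (7 ^ 3 * (y ^ n) ^ 3)" by (simp add: s power_add)
  also have "\<dots> < 7 ^ s * (8 ^ 3 * (3 ^ n) ^ D * (w ^ n) ^ 3)" using b by simp
  also have "\<dots> \<le> 8 ^ s * (8 ^ 3 * (3 ^ n) ^ D * (w ^ n) ^ 3)"
    by (intro mult_right_mono power_mono) auto
  also have "\<dots> = 8 ^ n * (3 ^ n) ^ D * (w ^ n) ^ 3" by (simp add: s power_add)
  finally show False using a by simp
qed

lemma ratio_bound_below:
  fixes y w n r :: nat
  assumes n: "n \<ge> 3" and ineq: "w ^ n < r * n * y ^ n" and r: "r > 0"
  shows "w ^ 3 < 3 * r * y ^ 3"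
proof (rule ccontr)
  assume "\<not> ?thesis"
  then have "(3 * r * y ^ 3) ^ n \<le> (w ^ 3) ^ n" by (intro power_mono) auto
  then have a: "3 ^ n * r ^ n * (y ^ n) ^ 3 \<le> (w ^ n) ^ 3"
    by (simp add: power_mult_distrib power_mult[symmetric] mult.commute)
  have "(w ^ n) ^ 3 < (r * n * y ^ n) ^ 3" using ineq by (intro power_strict_mono) auto
  also have "\<dots> = n ^ 3 * r ^ 3 * (y ^ n) ^ 3" by (simp add: power_mult_distrib)
  also have "\<dots> \<le> 3 ^ n * r ^ n * (y ^ n) ^ 3"
    using cube_le_three_power[OF n] n r by (intro mult_right_mono mult_mono power_increasing) auto
  finally show False using a by simp
qed

lemma geom_upper: "K \<ge> 8 \<Longrightarrow> m \<ge> 1 \<Longrightarrow> 7 * geom m K < 8 * K ^ (m - 1)"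
proof -
  assume K: "K \<ge> 8" and m: "m \<ge> 1"
  have g: "(K - 1) * geom m K + 1 = K * K ^ (m - 1)"
    using geom_geometric[of K m] K m by (cases m) auto
  have "7 * K * geom m K \<le> 8 * (K - 1) * geom m K" using K by (intro mult_right_mono) auto
  also have "\<dots> < 8 * ((K - 1) * geom m K + 1)" by simp
  also have "\<dots> = K * (8 * K ^ (m - 1))" using g by simp
  finally have "K * (7 * geom m K) < K * (8 * K ^ (m - 1))" by (simp add: mult_ac)
  then show ?thesis by simp
qed

section \<open>A search over exponents\<close>

text \<open>The program below is evaluated by rewriting on binary numerals, where a division costs far more than a few
multiplications. The inner loop therefore reduces modulo \<open>M\<close> by Barrett's method: \<open>\<mu>\<close> approximates \<open>4 * 4 ^ a / M\<close>, the quotient is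
estimated from below by shifts, and \<open>adjust\<close> subtracts the missing multiples of \<open>M\<close>.\<close>

function adjust :: "int \<Rightarrow> int \<Rightarrow> int" where
  "adjust M r = (if M \<le> 0 \<or> r < M then r else adjust M (r - M))"
  by pat_completeness auto
termination by (relation "measure (\<lambda>(M, r). nat r)") auto
declare adjust.simps [simp del]

fun red :: "int \<times> nat \<times> int \<Rightarrow> int \<Rightarrow> int" where
  "red (M, a, \<mu>) x = adjust M (x - drop_bit (Suc (Suc a)) (drop_bit a x * \<mu>) * M)"

definition red_square :: "int \<times> nat \<times> int \<Rightarrow> int \<Rightarrow> int" where
  "red_square b y = red b (y * y)"

definition mod_square :: "int \<Rightarrow> int \<Rightarrow> int" where
  "mod_square M y = y * y mod M"

fun red_pow :: "int \<times> nat \<times> int \<Rightarrow> int \<Rightarrow> num \<Rightarrow> int" where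
  "red_pow b x num.One = red b x"
| "red_pow b x (num.Bit0 n) = red_square b (red_pow b x n)"
| "red_pow b x (num.Bit1 n) = red b (red_square b (red_pow b x n) * x)"

fun mod_pow :: "int \<Rightarrow> int \<Rightarrow> num \<Rightarrow> int" where
  "mod_pow M x num.One = x mod M"
| "mod_pow M x (num.Bit0 n) = mod_square M (mod_pow M x n)"
| "mod_pow M x (num.Bit1 n) = mod_square M (mod_pow M x n) * x mod M"

definition refute_mod :: "int \<Rightarrow> int \<Rightarrow> num \<Rightarrow> int \<Rightarrow> bool" where
  "refute_mod Q y n z \<longleftrightarrow> z * mod_pow Q y n mod Q \<noteq> 1"

text \<open>A candidate \<open>z\<close> for \<open>C\<close> agrees with the congruence modulo \<open>g ^ e\<close>, with \<open>g\<close> a divisor of \<open>u\<close>. It is refuted by the congruence modulo a higher power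
of \<open>u\<close>; the exponent of that power may not exceed \<open>n\<close>, since only \<open>u ^ n\<close> is known to divide \<open>C * y ^ n - 1\<close>.\<close>

fun refute_candidate :: "int \<Rightarrow> int \<Rightarrow> num \<Rightarrow> num \<times> int \<Rightarrow> bool" where
  "refute_candidate u y e (n, z) \<longleftrightarrow>
     (if e + e \<le> n then refute_mod (u ^ nat_of_num (e + e)) y n z else refute_mod (u ^ nat_of_num n) y n z)"

text \<open>The state holds the exponent \<open>n\<close>, the inverse of \<open>y ^ n\<close> modulo \<open>M\<close>, and the candidates recorded so far. The congruence \<open>C * y ^ n \<equiv> 1\<close>
says that \<open>C\<close> is this inverse, provided \<open>C < M\<close>.\<close>

fun step :: "int \<times> nat \<times> int \<Rightarrow> int \<Rightarrow> int \<Rightarrow> num \<times> int \<times> (num \<times> int) list \<Rightarrow> num \<times> int \<times> (num \<times> int) list" where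
  "step b f \<kappa> (n, z, acc) =
     (n + num.One, red b (z * \<kappa>), if z \<le> f * Int.Pos n then if f * Int.Pos n mod z = 0 then (n, z) # acc else acc else acc)"

text \<open>Halving the count keeps the terms that are rewritten small; a unary counter would be traversed again at each step.\<close>

function steps :: "int \<times> nat \<times> int \<Rightarrow> int \<Rightarrow> int \<Rightarrow> int \<Rightarrow> num \<times> int \<times> (num \<times> int) list \<Rightarrow> num \<times> int \<times> (num \<times> int) list" where
  "steps b f \<kappa> K st = (if K \<le> 1 then step b f \<kappa> st
     else steps b f \<kappa> (drop_bit 1 K) (steps b f \<kappa> (K - drop_bit 1 K) st))"
  by pat_completeness auto
termination by (relation "measure (\<lambda>(b, f, \<kappa>, K, st). nat K)") (auto simp: drop_bit_eq_div)
declare steps.simps [simp del]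

fun all_refuted :: "int \<Rightarrow> int \<Rightarrow> num \<Rightarrow> int \<times> nat \<times> int \<Rightarrow> int \<Rightarrow> num \<times> int \<times> (num \<times> int) list \<Rightarrow> bool" where
  "all_refuted u y e b f (n, z, acc) \<longleftrightarrow> f * Int.Pos n \<le> fst b \<and> list_all (refute_candidate u y e) acc"

text \<open>The searches for an inverse modulo \<open>u\<close> and for its Newton lift only make a guess; \<open>scan\<close> tests the inverse that they
return. The value \<open>0\<close> reports that there is none.\<close>

function inverse_search :: "int \<Rightarrow> int \<Rightarrow> int \<Rightarrow> int \<Rightarrow> int" where
  "inverse_search u r c t =
    (if t = 1 then c else if u \<le> c then 0
     else inverse_search u r (c + 1) (if t + r < u then t + r else t + r - u))"
  by pat_completeness auto
termination by (relation "measure (\<lambda>(u, r, c, t). nat (u - c))") auto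
declare inverse_search.simps [simp del]

fun newton :: "int \<times> nat \<times> int \<Rightarrow> int \<Rightarrow> nat \<Rightarrow> int \<Rightarrow> int" where
  "newton b y 0 x = x"
| "newton b y (Suc i) x = newton b y i (red b (x * (fst b + 2 - red b (y * x))))"

text \<open>For positive \<open>d\<close>, and \<open>J = 2 ^ j\<close> at the start, the result \<open>j\<close> satisfies \<open>t \<le> 2 ^ j * d\<close>, as required by \<open>exponent_bound\<close>. Every second \<open>j\<close> is skipped, which costs
little precision.\<close>

function log_search :: "int \<Rightarrow> int \<Rightarrow> int \<Rightarrow> int \<Rightarrow> int" where
  "log_search d t j J = (if d \<le> 0 \<or> J \<le> 0 \<or> t \<le> J * d then j else log_search d t (j + 2) (4 * J))"
  by pat_completeness auto
termination
proof (relation "measure (\<lambda>(d, t, j, J). nat (t - J * d))")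
  fix d t j J :: int
  assume "\<not> (d \<le> 0 \<or> J \<le> 0 \<or> t \<le> J * d)"
  then have "d > 0" "J > 0" "t > J * d" by auto
  then have "J * d > 0" by simp
  with \<open>t > J * d\<close> show "((d, t, j + 2, 4 * J), d, t, j, J) \<in> measure (\<lambda>(d, t, j, J). nat (t - J * d))"
    by (simp add: algebra_simps)
qed simp
declare log_search.simps [simp del]

definition scan :: "int \<Rightarrow> int \<Rightarrow> num \<Rightarrow> int \<times> nat \<times> int \<Rightarrow> int \<Rightarrow> int \<Rightarrow> num \<Rightarrow> int \<Rightarrow> bool" where
  "scan u y e b f K n \<kappa> \<longleftrightarrow>
     0 \<le> \<kappa> \<and> red b (\<kappa> * y) = 1 \<and> all_refuted u y e b f (steps b f \<kappa> K (n, red_pow b \<kappa> n, []))"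

definition newton_steps :: "num \<Rightarrow> nat" where
  "newton_steps e = (if e \<le> num.Bit0 num.One then Suc 0 else if e \<le> num.Bit0 (num.Bit0 num.One) then Suc (Suc 0)
     else if e \<le> num.Bit0 (num.Bit0 (num.Bit0 num.One)) then Suc (Suc (Suc 0)) else Suc (Suc (Suc (Suc (Suc 0)))))"

definition scan_inverse :: "int \<Rightarrow> int \<Rightarrow> num \<Rightarrow> int \<times> nat \<times> int \<Rightarrow> int \<Rightarrow> int \<Rightarrow> num \<Rightarrow> int \<Rightarrow> bool" where
  "scan_inverse u y e b f K n c \<longleftrightarrow>
     (if c = 0 then gcd u y \<noteq> 1 else scan u y e b f K n (newton b y (newton_steps e) c))"

definition scan_residue :: "int \<Rightarrow> int \<Rightarrow> num \<Rightarrow> int \<times> nat \<times> int \<Rightarrow> int \<Rightarrow> int \<Rightarrow> num \<Rightarrow> int \<Rightarrow> bool" where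
  "scan_residue u y e b f K n r \<longleftrightarrow> scan_inverse u y e b f K n (inverse_search u r 1 r)"

definition scan_count :: "int \<Rightarrow> int \<Rightarrow> num \<Rightarrow> int \<times> nat \<times> int \<Rightarrow> int \<Rightarrow> num \<Rightarrow> int \<Rightarrow> bool" where
  "scan_count u y e b f n K \<longleftrightarrow> (if K \<le> 0 then True else scan_residue u y e b f K n (y mod u))"

definition scan_bound :: "int \<Rightarrow> int \<Rightarrow> num \<Rightarrow> int \<times> nat \<times> int \<Rightarrow> num \<Rightarrow> int \<Rightarrow> int \<Rightarrow> int \<Rightarrow> int \<Rightarrow> int \<Rightarrow> bool" where
  "scan_bound u y e b n h E f d \<sigma> \<longleftrightarrow>
     scan_count u y e b h n
       (\<sigma> * (E * (25 * log_search d (2 * E * f * \<sigma>) 2 4 - 36) + 6) div (54 * d) + 1 - Int.Pos n)"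

definition check_pair :: "int \<Rightarrow> int \<Rightarrow> int \<Rightarrow> int list \<Rightarrow> bool \<Rightarrow> int \<Rightarrow> num \<Rightarrow> int \<times> nat \<times> int \<Rightarrow> num \<Rightarrow> int \<Rightarrow> bool" where
  "check_pair h E w excl sk u e b n y \<longleftrightarrow>
     (if list_ex (\<lambda>p. y mod p = 0) excl then True
      else if w < y then (if sk \<and> y - w = 1 then True else scan_bound u y e b n h E 1 (y - w) (y + w))
      else if y < w then (if sk \<and> w - y = 1 then True else scan_bound u y e b n h 1 h (w - y) (y + w))
      else True)"

function check_range :: "int \<Rightarrow> int \<Rightarrow> int \<Rightarrow> int \<Rightarrow> int list \<Rightarrow> bool \<Rightarrow> int \<Rightarrow> num \<Rightarrow> int \<times> nat \<times> int \<Rightarrow> num \<Rightarrow> int \<Rightarrow> int \<Rightarrow> bool" where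
  "check_range h E w st excl sk u e b n z y =
    (if st \<le> 0 \<or> z < y then True
     else check_pair h E w excl sk u e b n y \<and> check_range h E w st excl sk u e b n z (y + st))"
  by pat_completeness auto
termination by (relation "measure (\<lambda>(h, E, w, st, excl, sk, u, e, b, n, z, y). nat (z + 1 - y))") auto
declare check_range.simps [simp del]

function bit_search :: "int \<Rightarrow> nat \<Rightarrow> int \<Rightarrow> int \<times> nat \<times> int" where
  "bit_search M a p = (if p \<le> 0 \<or> M < 2 * p then (M, a, 4 * p * p div M) else bit_search M (Suc a) (2 * p))"
  by pat_completeness auto
termination by (relation "measure (\<lambda>(M, a, p). nat (M - p))") auto
declare bit_search.simps [simp del]

text \<open>A guess for the integer part of the \<open>n\<close>-th root of \<open>A / C\<close>; \<open>brackets\<close> and \<open>covers\<close> test the bounds that it is used for.\<close>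

function bisect :: "int \<Rightarrow> int \<Rightarrow> nat \<Rightarrow> int \<Rightarrow> int \<Rightarrow> int" where
  "bisect A C n lo hi = (if hi \<le> lo + 1 then lo else
     if C * drop_bit 1 (lo + hi) ^ n < A then bisect A C n (drop_bit 1 (lo + hi)) hi
     else bisect A C n lo (drop_bit 1 (lo + hi)))"
  by pat_completeness auto
termination by (relation "measure (\<lambda>(A, C, n, lo, hi). nat (hi - lo))") (auto simp: drop_bit_eq_div)
declare bisect.simps [simp del]

definition brackets :: "int \<Rightarrow> int \<Rightarrow> int \<Rightarrow> nat \<Rightarrow> int \<Rightarrow> bool" where
  "brackets u A C n y \<longleftrightarrow> 0 \<le> y \<and> C * y ^ n < A \<and> (8896 < u * (y + 1) \<or> A < C * (y + 1) ^ n)"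

definition not_power :: "int \<Rightarrow> int \<Rightarrow> int \<Rightarrow> nat \<Rightarrow> bool" where
  "not_power u A C n \<longleftrightarrow> brackets u A C n (bisect A C n 1 (8896 div u + 1))"

fun geom_int :: "nat \<Rightarrow> int \<Rightarrow> int" where
  "geom_int 0 b = 0" | "geom_int (Suc m) b = 1 + b * geom_int m b"

text \<open>For odd \<open>r\<close> both \<open>geom r T\<close> and \<open>y\<close> are odd, \<open>y\<close> is \<open>1\<close> and \<open>geom r T\<close> is \<open>0\<close> or \<open>1\<close> modulo \<open>r\<close>; this leaves two
residues for \<open>C\<close> modulo \<open>2 r\<close>. For \<open>r = 2\<close> the corresponding statement concerns \<open>b\<^sup>2 + 1\<close> modulo \<open>4\<close>.\<close>

definition admissible :: "nat \<Rightarrow> int \<Rightarrow> bool" where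
  "admissible r C \<longleftrightarrow> (if r = 2 then C mod 4 = 1 \<or> C mod 4 = 2 else C mod (2 * int r) = 1 \<or> C mod (2 * int r) = int r)"

definition check_small_n1 :: "nat \<Rightarrow> int \<Rightarrow> int \<Rightarrow> bool \<Rightarrow> nat \<Rightarrow> int \<Rightarrow> bool" where
  "check_small_n1 r u q adm n A \<longleftrightarrow>
     list_all (\<lambda>C. if q mod C = 0 then (if adm \<longrightarrow> admissible r C then not_power u A C n else True) else True) [1..q]"

definition check_small_n :: "nat \<Rightarrow> nat \<Rightarrow> int \<Rightarrow> bool \<Rightarrow> int \<Rightarrow> int \<Rightarrow> bool" where
  "check_small_n r k h adm u n \<longleftrightarrow>
     list_all (\<lambda>n1. if n mod n1 = 0 then
        check_small_n1 r u (h * (n div n1)) adm (nat n) (geom_int r ((n1 * u ^ nat n) ^ k)) else True) [1..n]"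

text \<open>Below the exponent \<open>n0\<close> the modulus need not divide \<open>u ^ n\<close>. There the possible values of \<open>n1\<close> and \<open>C\<close> are enumerated and
\<open>geom r K / C\<close> is shown to lie strictly between two consecutive \<open>n\<close>-th powers, or \<open>y\<close> to be too large.\<close>

definition check_small :: "nat \<Rightarrow> nat \<Rightarrow> int \<Rightarrow> bool \<Rightarrow> int \<Rightarrow> num \<Rightarrow> bool" where
  "check_small r k h adm u n0 \<longleftrightarrow> list_all (check_small_n r k h adm u) [3..Int.Pos n0 - 1]"

definition round_up :: "int \<Rightarrow> int \<Rightarrow> int \<Rightarrow> int" where
  "round_up y0 st a = a + (y0 - a) mod st"

text \<open>By \<open>ratio_bound_below\<close> and \<open>ratio_bound_above\<close>, no solution has \<open>y \<le> a\<close> or \<open>y > z\<close>.\<close>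

definition covers :: "int \<Rightarrow> int \<Rightarrow> int \<Rightarrow> int \<Rightarrow> int \<Rightarrow> int \<Rightarrow> bool" where
  "covers h D3 u W a z \<longleftrightarrow> 3 * h * a ^ 3 \<le> W \<and> (8896 < u * (z + 1) \<or> 8 * D3 * W \<le> 7 * (z + 1) ^ 3)"

definition check_interval :: "int \<Rightarrow> nat \<Rightarrow> int \<Rightarrow> int \<Rightarrow> int \<Rightarrow> int list \<Rightarrow> bool \<Rightarrow> int \<Rightarrow> int \<Rightarrow> num \<Rightarrow> int \<times> nat \<times> int \<Rightarrow> num \<Rightarrow> int \<Rightarrow> int \<Rightarrow> bool" where
  "check_interval h D D3 st y0 excl sk u w e b n0 a z \<longleftrightarrow>
     covers h D3 u (w ^ 3) a z \<and> check_range h (int D) w st excl sk u e b n0 z (round_up y0 st (a + 1))"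

definition check_mod :: "nat \<Rightarrow> nat \<Rightarrow> int \<Rightarrow> bool \<Rightarrow> int \<Rightarrow> int \<Rightarrow> int list \<Rightarrow> int \<Rightarrow> int \<Rightarrow> num \<Rightarrow> int \<times> nat \<times> int \<Rightarrow> num \<Rightarrow> bool" where
  "check_mod r k h adm st y0 excl u w e b n0 \<longleftrightarrow>
     check_small r k h adm u n0 \<and>
     check_interval h (k * (r - 1)) (3 ^ (k * (r - 1))) st y0 excl (\<not> adm \<and> 10 \<le> u) u w e b n0
       (bisect (w ^ 3 + 1) (3 * h) 3 0 8897) (bisect (8 * 3 ^ (k * (r - 1)) * w ^ 3) 7 3 1 (8896 div u + 1))"

fun check_base :: "nat \<Rightarrow> nat \<Rightarrow> int \<Rightarrow> bool \<Rightarrow> int \<Rightarrow> int \<Rightarrow> int list \<Rightarrow> int \<Rightarrow> int \<times> num \<Rightarrow> bool" where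
  "check_base r k h adm st y0 excl u (M, e) =
     check_mod r k h adm st y0 excl u (u ^ (k * (r - 1))) e (bit_search M 0 1)
       (if e \<le> num.Bit1 num.One then num.Bit1 num.One else e)"

text \<open>\<open>st\<close> and \<open>y0\<close> give the residue class of \<open>y\<close>, \<open>excl\<close> lists primes that cannot divide \<open>y\<close>, and \<open>h\<close> is a multiplier such that \<open>C\<close>
divides \<open>h n\<close>. The modulus \<open>g ^ e\<close> with \<open>g dvd u\<close> must exceed all occurring \<open>h n\<close>.\<close>

definition check_u :: "nat \<Rightarrow> nat \<Rightarrow> int \<Rightarrow> bool \<Rightarrow> int \<Rightarrow> int \<Rightarrow> int list \<Rightarrow> int \<times> int \<times> nat \<Rightarrow> bool" where
  "check_u r k h adm st y0 excl uge = (case uge of (u, g, e) \<Rightarrow> 1 < g \<and> 1 < u \<and> 0 < e \<and> u mod g = 0 \<and>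
     check_base r k h adm st y0 excl u (g ^ e, num_of_nat e))"

section \<open>Soundness of the search\<close>

lemma adjust_eq_mod: "0 < M \<Longrightarrow> 0 \<le> r \<Longrightarrow> adjust M r = r mod M"
proof (induction M r rule: adjust.induct)
  case (1 M r)
  show ?case
  proof (cases "r < M")
    case True
    with 1 show ?thesis by (subst adjust.simps) simp
  next
    case False
    with 1 have "adjust M (r - M) = (r - M) mod M" by simp
    with False 1 show ?thesis by (subst adjust.simps) simp
  qed
qed

lemma div_mult_le: "0 < d \<Longrightarrow> a div d * d \<le> a" for a d :: int
  using minus_mod_eq_div_mult[of a d] pos_mod_sign[of d a] by linarith

definition barrett :: "int \<times> nat \<times> int \<Rightarrow> bool" where
  "barrett b \<longleftrightarrow> (case b of (M, a, \<mu>) \<Rightarrow> 0 < M \<and> 0 \<le> \<mu> \<and> \<mu> * M \<le> 4 * 2 ^ a * 2 ^ a)"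

lemma red_eq_mod:
  assumes b: "barrett b" and x: "0 \<le> x"
  shows "red b x = x mod fst b"
proof -
  obtain M a \<mu> where e: "b = (M, a, \<mu>)" by (cases b)
  have M: "0 < M" "0 \<le> \<mu>" "\<mu> * M \<le> 4 * 2 ^ a * 2 ^ a" using b by (auto simp: e barrett_def)
  define q where "q = drop_bit (Suc (Suc a)) (drop_bit a x * \<mu>)"
  define X where "X = x div 2 ^ a"
  have X: "0 \<le> X" "X * 2 ^ a \<le> x" using x by (auto simp: X_def pos_imp_zdiv_nonneg_iff div_mult_le)
  have "q = (X * \<mu>) div (4 * 2 ^ a)" by (simp add: q_def X_def drop_bit_eq_div)
  then have "q * (4 * 2 ^ a) \<le> X * \<mu>" by (simp add: div_mult_le)
  then have "q * (4 * 2 ^ a) * M \<le> X * \<mu> * M" using M by (intro mult_right_mono) auto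
  also have "\<dots> \<le> X * (4 * 2 ^ a * 2 ^ a)" using X(1) M(3) by (simp add: mult.assoc mult_left_mono)
  also have "\<dots> = 4 * 2 ^ a * (X * 2 ^ a)" by simp
  also have "\<dots> \<le> 4 * 2 ^ a * x" using X(2) by (intro mult_left_mono) auto
  finally have "4 * 2 ^ a * (q * M) \<le> 4 * 2 ^ a * x" by (simp add: mult_ac)
  then have "q * M \<le> x" by simp
  then have "red b x = (x - q * M) mod M"
    using M by (simp add: e q_def adjust_eq_mod)
  also have "\<dots> = x mod M" by (simp add: mod_diff_eq[symmetric, of x "q * M"] )
  finally show ?thesis by (simp add: e)
qed

lemma red_pow_eq: "barrett b \<Longrightarrow> 0 \<le> x \<Longrightarrow> red_pow b x n = x ^ nat_of_num n mod fst b"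
proof (induction n)
  case (Bit0 n)
  then have IH: "red_pow b x n = x ^ nat_of_num n mod fst b" and M: "0 < fst b"
    by (auto simp: barrett_def)
  have "0 \<le> red_pow b x n" using M by (simp add: IH)
  then show ?case using Bit0.prems
    by (simp add: red_square_def red_eq_mod power_add) (simp add: IH mod_mult_eq)
next
  case (Bit1 n)
  then have IH: "red_pow b x n = x ^ nat_of_num n mod fst b" and M: "0 < fst b"
    by (auto simp: barrett_def)
  have "0 \<le> red_pow b x n" using M by (simp add: IH)
  then have "red_square b (red_pow b x n) = x ^ (nat_of_num n + nat_of_num n) mod fst b"
    using Bit1.prems by (simp add: red_square_def red_eq_mod power_add) (simp add: IH mod_mult_eq)
  then have "red_pow b x (num.Bit1 n) = (x ^ (nat_of_num n + nat_of_num n) mod fst b * x) mod fst b"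
    using Bit1.prems M by (simp add: red_eq_mod)
  then show ?case by (simp add: mult.commute mod_mult_right_eq)
qed (simp add: red_eq_mod)

lemma mod_pow_eq: "mod_pow M x n = x ^ nat_of_num n mod M"
proof (induction n)
  case (Bit0 n)
  then show ?case by (simp add: mod_square_def power_add mod_mult_eq)
next
  case (Bit1 n)
  then have "mod_pow M x (num.Bit1 n) = (x ^ (nat_of_num n + nat_of_num n) mod M * x) mod M"
    by (simp add: mod_square_def power_add mod_mult_eq)
  then show ?case by (simp add: mult.commute mod_mult_right_eq)
qed simp

lemma nat_of_num_inc: "nat_of_num (n + num.One) = Suc (nat_of_num n)"
  by (simp add: nat_of_num_add)

lemma Pos_eq: "Int.Pos n = int (nat_of_num n)"
  by (simp add: nat_of_num_numeral)

lemma steps_eq_funpow: "steps b f \<kappa> K st = (step b f \<kappa> ^^ max 1 (nat K)) st"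
proof (induction b f \<kappa> K st rule: steps.induct)
  case (1 b f \<kappa> K st)
  show ?case
  proof (cases "K \<le> 1")
    case True
    then have "max 1 (nat K) = 1" by simp
    then show ?thesis using True by (subst steps.simps) simp
  next
    case False
    \<comment> \<open>Both halves are at least \<open>1\<close>, so the cut-off at \<open>K \<le> 1\<close> never adds a step.\<close>
    define h where "h = drop_bit 1 K"
    have h: "1 \<le> h" "1 \<le> K - h" using False by (auto simp: h_def drop_bit_eq_div)
    have "steps b f \<kappa> K st = steps b f \<kappa> h (steps b f \<kappa> (K - h) st)"
      using False by (subst steps.simps) (simp add: h_def)
    also have "\<dots> = (step b f \<kappa> ^^ max 1 (nat h)) ((step b f \<kappa> ^^ max 1 (nat (K - h))) st)"
      using 1[OF False] by (simp add: h_def)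
    also have "\<dots> = (step b f \<kappa> ^^ (nat h + nat (K - h))) st"
    proof -
      have "max 1 (nat h) = nat h" "max 1 (nat (K - h)) = nat (K - h)" using h by auto
      then show ?thesis by (simp only: funpow_add o_apply)
    qed
    also have "nat h + nat (K - h) = max 1 (nat K)" using h by simp
    finally show ?thesis .
  qed
qed

lemma funpow_step:
  assumes b: "barrett b" and \<kappa>: "0 \<le> \<kappa>" and z: "z = \<kappa> ^ nat_of_num n mod fst b"
  shows "\<exists>n' z' acc'. (step b f \<kappa> ^^ i) (n, z, acc) = (n', z', acc') \<and> nat_of_num n' = nat_of_num n + i \<and>
    z' = \<kappa> ^ (nat_of_num n + i) mod fst b \<and>
    (\<forall>N. nat_of_num n \<le> N \<and> N < nat_of_num n + i \<and> \<kappa> ^ N mod fst b \<le> f * int N \<and>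
        f * int N mod (\<kappa> ^ N mod fst b) = 0 \<longrightarrow>
      (\<exists>m. nat_of_num m = N \<and> (m, \<kappa> ^ N mod fst b) \<in> set acc'))"
proof (induction i)
  case 0
  show ?case using z by auto
next
  case (Suc i)
  then obtain n' z' acc' where st: "(step b f \<kappa> ^^ i) (n, z, acc) = (n', z', acc')"
    and n': "nat_of_num n' = nat_of_num n + i" and z': "z' = \<kappa> ^ (nat_of_num n + i) mod fst b"
    and hits: "\<forall>N. nat_of_num n \<le> N \<and> N < nat_of_num n + i \<and> \<kappa> ^ N mod fst b \<le> f * int N \<and>
        f * int N mod (\<kappa> ^ N mod fst b) = 0 \<longrightarrow> (\<exists>m. nat_of_num m = N \<and> (m, \<kappa> ^ N mod fst b) \<in> set acc')"
    by blast
  define acc2 where "acc2 = (if z' \<le> f * Int.Pos n' then if f * Int.Pos n' mod z' = 0 then (n', z') # acc' else acc' else acc')"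
  have "0 < fst b" using b by (auto simp: barrett_def)
  then have "0 \<le> z' * \<kappa>" using z' \<kappa> by simp
  then have rz: "red b (z' * \<kappa>) = \<kappa> ^ (nat_of_num n + Suc i) mod fst b"
    using b by (simp add: red_eq_mod z' mult.commute mod_mult_right_eq)
  have "(step b f \<kappa> ^^ Suc i) (n, z, acc) = (n' + num.One, \<kappa> ^ (nat_of_num n + Suc i) mod fst b, acc2)"
    unfolding funpow.simps o_apply st step.simps acc2_def rz ..
  moreover have "\<exists>m. nat_of_num m = N \<and> (m, \<kappa> ^ N mod fst b) \<in> set acc2"
    if N: "nat_of_num n \<le> N" "N < nat_of_num n + Suc i" "\<kappa> ^ N mod fst b \<le> f * int N"
      "f * int N mod (\<kappa> ^ N mod fst b) = 0" for N
  proof (cases "N < nat_of_num n + i")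
    case True
    have "\<exists>m. nat_of_num m = N \<and> (m, \<kappa> ^ N mod fst b) \<in> set acc'"
      by (rule hits[THEN spec, THEN mp]) (intro conjI N True)
    then show ?thesis by (auto simp: acc2_def)
  next
    case False
    then have "N = nat_of_num n'" using N n' by simp
    then have "z' \<le> f * Int.Pos n' \<and> f * Int.Pos n' mod z' = 0" using N(3,4) unfolding z' Pos_eq n' by simp
    then have "(n', z') \<in> set acc2" by (simp add: acc2_def)
    then show ?thesis using \<open>N = nat_of_num n'\<close> z' n' by (intro exI[of _ n']) simp
  qed
  ultimately show ?case by (auto simp: nat_of_num_inc n')
qed

lemma refute_sound:
  assumes r: "refute_candidate u y e (n, z)" and u: "2 \<le> u"
    and c: "[z * y ^ nat_of_num n = 1] (mod u ^ nat_of_num n)"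
  shows False
proof -
  have *: False if "refute_mod (u ^ E) y n z" "E \<le> nat_of_num n" "0 < E" for E
  proof -
    have "[z * y ^ nat_of_num n = 1] (mod u ^ E)"
      using c that(2) by (meson cong_dvd_modulus le_imp_power_dvd)
    moreover have "1 < u ^ E" using u that(3) by (intro one_less_power) auto
    ultimately have "z * y ^ nat_of_num n mod u ^ E = 1" by (simp add: cong_def)
    then show False using that(1) by (simp add: refute_mod_def mod_pow_eq mod_mult_right_eq)
  qed
  have "(if e + e \<le> n then refute_mod (u ^ nat_of_num (e + e)) y n z else refute_mod (u ^ nat_of_num n) y n z)"
    using r by simp
  then show False using *[of "nat_of_num (e + e)"] *[of "nat_of_num n"] nat_of_num_pos
    by (auto simp: less_eq_num_def split: if_splits)
qed

text \<open>If \<open>C\<close> existed, it would be the inverse of \<open>y ^ N\<close> modulo \<open>M\<close>. As \<open>C \<le> f N < M\<close>, it would be the recorded residue itself, and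
this residue has been refuted.\<close>

lemma scan_sound:
  assumes s: "scan u y e b f K n \<kappa>" and b: "barrett b" and u: "2 \<le> u" and f: "1 \<le> f"
    and K: "1 \<le> K" and N: "nat_of_num n \<le> N" "int N < Int.Pos n + K"
    and C: "0 < C" "C dvd f * int N" "[C * y ^ N = 1] (mod u ^ N)" and M: "fst b dvd u ^ N"
    and y: "0 \<le> y"
  shows False
proof -
  define i where "i = nat K"
  have \<kappa>: "0 \<le> \<kappa>" "red b (\<kappa> * y) = 1" and ar: "all_refuted u y e b f (steps b f \<kappa> K (n, red_pow b \<kappa> n, []))"
    using s by (auto simp: scan_def)
  have M0: "0 < fst b" using b by (auto simp: barrett_def)
  have "(\<kappa> * y) mod fst b = 1" using \<kappa> y b by (simp add: red_eq_mod)
  then have M1: "fst b \<noteq> 1" by auto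
  then have "[\<kappa> * y = 1] (mod fst b)" using \<open>(\<kappa> * y) mod fst b = 1\<close> M0 by (simp add: cong_def)
  then have ky: "[(\<kappa> * y) ^ N = 1] (mod fst b)" using cong_pow by fastforce
  obtain n' z' acc where st: "steps b f \<kappa> K (n, red_pow b \<kappa> n, []) = (n', z', acc)"
    and n': "nat_of_num n' = nat_of_num n + i"
    and acc: "\<And>N. nat_of_num n \<le> N \<Longrightarrow> N < nat_of_num n + i \<Longrightarrow> \<kappa> ^ N mod fst b \<le> f * int N \<Longrightarrow>
      f * int N mod (\<kappa> ^ N mod fst b) = 0 \<Longrightarrow> \<exists>m. nat_of_num m = N \<and> (m, \<kappa> ^ N mod fst b) \<in> set acc"
  proof -
    have "max 1 (nat K) = i" using K by (simp add: i_def)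
    then show ?thesis
      using funpow_step[OF b \<kappa>(1) red_pow_eq[OF b \<kappa>(1), of n], where i = i and f = f and acc = "[]"] that
      by (auto simp: steps_eq_funpow)
  qed
  have lt: "f * int (nat_of_num n + i) \<le> fst b" and rf: "\<And>p. p \<in> set acc \<Longrightarrow> refute_candidate u y e p"
    using ar n' Pos_eq[of n'] by (auto simp: st list_all_iff)
  have Ni: "N < nat_of_num n + i" using N K unfolding i_def Pos_eq by linarith
  have "C \<le> f * int N" using C f N(1) nat_of_num_pos[of n] by (intro zdvd_imp_le) auto
  moreover have "f * int N < f * int (nat_of_num n + i)" using Ni f by simp
  ultimately have CM: "C < fst b" using lt by linarith
  have "[C * y ^ N = 1] (mod fst b)" using C(3) M by (rule cong_dvd_modulus)
  then have "[C * y ^ N * \<kappa> ^ N = 1 * \<kappa> ^ N] (mod fst b)" by (intro cong_mult) auto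
  moreover have "[C * (\<kappa> * y) ^ N = C * 1] (mod fst b)" using ky by (intro cong_mult) auto
  moreover have "C * (\<kappa> * y) ^ N = C * y ^ N * \<kappa> ^ N" by (simp add: power_mult_distrib mult_ac)
  ultimately have "[C = \<kappa> ^ N] (mod fst b)" by (simp add: cong_def)
  then have Ck: "C = \<kappa> ^ N mod fst b" using CM C(1) by (simp add: cong_def)
  then obtain m where m: "nat_of_num m = N" "(m, C) \<in> set acc"
    using acc[OF N(1) Ni] \<open>C \<le> f * int N\<close> C(2) by (auto simp: dvd_imp_mod_0)
  show False
    using refute_sound[OF rf[OF m(2)] u] C m(1) Pos_eq[of m] by auto
qed

lemma log_search_sound:
  "0 < d \<Longrightarrow> 0 \<le> j \<Longrightarrow> J = 2 ^ nat j \<Longrightarrow>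
    0 \<le> log_search d t j J \<and> t \<le> 2 ^ nat (log_search d t j J) * d"
proof (induction d t j J rule: log_search.induct)
  case (1 d t j J)
  show ?case
  proof (cases "t \<le> J * d")
    case True
    then have "log_search d t j J = j" by (subst log_search.simps) simp
    with True 1 show ?thesis by simp
  next
    case False
    then have e: "log_search d t j J = log_search d t (j + 2) (4 * J)"
      using 1 by (subst log_search.simps) simp
    have "4 * J = 2 ^ nat (j + 2)" using 1 by (simp add: nat_add_distrib power_add)
    with 1 False e show ?thesis by simp
  qed
qed

text \<open>The equation that is searched: \<open>geom r K = C y\<^sup>n\<close> with \<open>K = (n1 u\<^sup>n) ^ k\<close>, together with the divisibility
and size information available from the original problem.\<close>

definition solution :: "nat \<Rightarrow> nat \<Rightarrow> nat \<Rightarrow> nat \<Rightarrow> nat \<Rightarrow> nat \<Rightarrow> nat \<Rightarrow> nat \<Rightarrow> bool" where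
  "solution r k h u n n1 C y \<longleftrightarrow> 2 \<le> u \<and> 2 \<le> y \<and> 3 \<le> n \<and> 0 < n1 \<and> n1 dvd n \<and> 0 < C \<and>
     C * n1 dvd h * n \<and> coprime u y \<and> u * y \<le> 8896 \<and> C * y ^ n = geom r ((n1 * u ^ n) ^ k)"

text \<open>A value strictly between two consecutive terms \<open>C * x ^ n\<close> is not of that form.\<close>

lemma not_power_sound:
  fixes u y n C :: nat
  assumes np: "not_power (int u) A (int C) n" and uy: "u * y \<le> 8896" shows "int C * int y ^ n \<noteq> A"
proof
  assume eq: "int C * int y ^ n = A"
  obtain x where x: "0 \<le> x" "int C * x ^ n < A" "8896 < int u * (x + 1) \<or> A < int C * (x + 1) ^ n"
    using np by (auto simp: not_power_def brackets_def)
  have "x < int y"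
  proof (rule ccontr)
    assume "\<not> x < int y"
    then have "int y ^ n \<le> x ^ n" by (intro power_mono) auto
    then have "int C * int y ^ n \<le> int C * x ^ n" by (intro mult_left_mono) auto
    then show False using eq x(2) by simp
  qed
  then have xy: "x + 1 \<le> int y" by simp
  have "int u * (x + 1) \<le> int u * int y" using xy by (intro mult_left_mono) auto
  moreover have "int u * int y \<le> 8896" using uy by (metis of_nat_le_iff of_nat_mult of_nat_numeral)
  moreover have "int C * (x + 1) ^ n \<le> int C * int y ^ n" using xy x(1) by (intro mult_left_mono power_mono) auto
  ultimately show False using x(3) eq by linarith
qed

lemma geom_int_eq: "geom_int m (int K) = int (geom m K)"
  by (induction m) (simp_all add: geom_Suc)

context
  fixes r k h u n n1 C y w D :: nat
  assumes sol: "solution r k h u n n1 C y" and rk: "2 \<le> r" "1 \<le> k" "1 \<le> h"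
    and D: "D = k * (r - 1)" and w: "w = u ^ D"
begin

lemma sol_facts:
  shows "2 \<le> u" "2 \<le> y" "3 \<le> n" "0 < n1" "n1 dvd n" "0 < C" "C * n1 dvd h * n" "coprime u y"
    "u * y \<le> 8896" "C * y ^ n = geom r ((n1 * u ^ n) ^ k)" "n1 \<le> n" "C \<le> h * n" "C dvd h * n"
proof -
  show f: "2 \<le> u" "2 \<le> y" "3 \<le> n" "0 < n1" "n1 dvd n" "0 < C" "C * n1 dvd h * n" "coprime u y"
    "u * y \<le> 8896" "C * y ^ n = geom r ((n1 * u ^ n) ^ k)"
    using sol by (auto simp: solution_def)
  show "n1 \<le> n" using f by (intro dvd_imp_le) auto
  show cd: "C dvd h * n" using f(7) by (rule dvd_mult_left)
  show "C \<le> h * n" using cd f rk by (intro dvd_imp_le) auto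
qed

lemma sol_cong: "[C * y ^ n = 1] (mod u ^ n)"
proof -
  obtain j where j: "r = Suc j" using rk by (cases r) auto
  have "u ^ n dvd (n1 * u ^ n) ^ k" using rk(2) by (intro dvd_trans[OF dvd_triv_right dvd_power]) auto
  then have "[1 + (n1 * u ^ n) ^ k * geom j ((n1 * u ^ n) ^ k) = 1 + 0] (mod u ^ n)"
    by (intro cong_add) (auto simp: cong_0_iff)
  then show ?thesis using sol_facts(10) by (simp add: j geom_Suc)
qed

lemma base_ge_8: "8 \<le> (n1 * u ^ n) ^ k"
proof -
  have "(8::nat) = 2 ^ 3" by simp
  also have "\<dots> \<le> u ^ 3" using sol_facts(1) by (intro power_mono) auto
  also have "\<dots> \<le> u ^ n" using sol_facts(1,3) by (intro power_increasing) auto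
  also have "\<dots> \<le> n1 * u ^ n" using sol_facts(4) by simp
  also have "\<dots> \<le> (n1 * u ^ n) ^ k" using rk(2) sol_facts(1,4) power_increasing[of 1 k "n1 * u ^ n"] by simp
  finally show ?thesis .
qed

lemma base_power: "((n1 * u ^ n) ^ k) ^ (r - 1) = n1 ^ D * w ^ n"
  by (simp add: D w power_mult_distrib power_mult[symmetric] mult_ac)

text \<open>The sum \<open>geom r K\<close> exceeds its top term \<open>K ^ (r - 1) = n1 ^ D * w ^ n\<close>, by a factor of at most \<open>8/7\<close>.\<close>

lemma sol_lower: "n1 ^ D * w ^ n < C * y ^ n"
proof -
  obtain j where j: "r = Suc (Suc j)" using rk(1) by (metis Suc_le_D numeral_2_eq_2 Suc_le_mono)
  have "geom r ((n1 * u ^ n) ^ k) = geom (Suc j) ((n1 * u ^ n) ^ k) + ((n1 * u ^ n) ^ k) ^ (r - 1)"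
    by (simp add: j geom_Suc_top)
  moreover have "0 < geom (Suc j) ((n1 * u ^ n) ^ k)" by (rule geom_pos) simp
  ultimately show ?thesis using sol_facts(10) base_power by simp
qed

lemma sol_upper: "7 * (C * y ^ n) < 8 * (n1 ^ D * w ^ n)"
  using geom_upper[OF base_ge_8, of r] rk(1) sol_facts(10) base_power by simp

lemma sol_above: "7 * y ^ n < 8 * n ^ D * w ^ n"
proof -
  have "7 * y ^ n \<le> 7 * (C * y ^ n)" using sol_facts(6) by simp
  also have "\<dots> < 8 * (n1 ^ D * w ^ n)" by (rule sol_upper)
  also have "\<dots> \<le> 8 * (n ^ D * w ^ n)"
    using sol_facts(11) by (intro mult_left_mono mult_right_mono power_mono) auto
  finally show ?thesis by (simp add: mult.assoc)
qed

lemma sol_below: "w ^ n < h * n * y ^ n"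
proof -
  have "1 * w ^ n \<le> n1 ^ D * w ^ n" using sol_facts(4) by (intro mult_right_mono) auto
  also have "\<dots> < C * y ^ n" by (rule sol_lower)
  also have "\<dots> \<le> h * n * y ^ n" using sol_facts(12) by (intro mult_right_mono) auto
  finally show ?thesis by simp
qed

lemma w_pos: "0 < w" using sol_facts(1) by (simp add: w)

lemma y_ne_w: "y \<noteq> w"
proof
  assume "y = w"
  have "D \<noteq> 0" using rk by (simp add: D)
  then have "u dvd w" by (simp add: w)
  then have "u dvd 1" using sol_facts(8) \<open>y = w\<close> by (metis coprime_common_divisor dvd_refl)
  then show False using sol_facts(1) by simp
qed

lemma scan_bound_sound:
  assumes s: "scan_bound (int u) (int y) e b n0 (int h) (int E) (int f) (int g1 - int g0) (int y + int w)"
    and g: "g0 < g1" "0 < g0" "g1 + g0 = y + w" and f: "1 \<le> f"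
    and bnd: "7 * g1 ^ n \<le> 8 * (f * n) ^ E * g0 ^ n"
    and b: "barrett b" "fst b dvd int u ^ n" and n0: "nat_of_num n0 \<le> n"
  shows False
proof -
  define d where "d = int g1 - int g0"
  define j where "j = log_search d (2 * int E * int f * (int y + int w)) 2 4"
  define Q where "Q = (int y + int w) * (int E * (25 * j - 36) + 6)"
  define K where "K = Q div (54 * d) + 1 - Int.Pos n0"
  have d0: "0 < d" using g by (simp add: d_def)
  have j: "0 \<le> j" "2 * int E * int f * (int y + int w) \<le> 2 ^ nat j * d"
    using log_search_sound[OF d0, of 2 4 "2 * int E * int f * (int y + int w)"] by (auto simp: j_def)
  have dg: "int (g1 - g0) = d" using g by (simp add: d_def)
  have "int (2 * E * f * (g1 + g0)) \<le> int (2 ^ nat j * (g1 - g0))"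
    using j(2) by (simp only: of_nat_mult dg g(3)) simp
  then have jn: "2 * E * f * (g1 + g0) \<le> 2 ^ nat j * (g1 - g0)" by (simp only: of_nat_le_iff)
  have "54 * int (g1 - g0) * int n \<le> int (g1 + g0) * (int E * (25 * int (nat j) - 36) + 6)"
    using sol_facts(3) f g by (intro exponent_bound[OF _ _ _ _ bnd jn]) auto
  then have "int n * (54 * d) \<le> Q" using j(1) by (simp add: dg Q_def g(3) mult_ac)
  then have "int n * (54 * d) div (54 * d) \<le> Q div (54 * d)" using d0 by (intro zdiv_mono1) auto
  then have "int n \<le> Q div (54 * d)" using d0 by simp
  then have nK: "int n < Int.Pos n0 + K" by (simp add: K_def)
  have "int (nat_of_num n0) \<le> int n" using n0 by simp
  then have K1: "1 \<le> K" using nK unfolding Pos_eq by linarith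
  have "scan_count (int u) (int y) e b (int h) n0 K"
    using s by (simp add: scan_bound_def K_def Q_def j_def d_def)
  then obtain c where c: "scan_inverse (int u) (int y) e b (int h) K n0 c"
    using K1 by (auto simp: scan_count_def scan_residue_def)
  have "gcd (int u) (int y) = 1" by (simp only: gcd_int_int_eq coprime_imp_gcd_eq_1[OF sol_facts(8)] of_nat_1)
  then obtain \<kappa> where "scan (int u) (int y) e b (int h) K n0 \<kappa>"
    using c by (auto simp: scan_inverse_def split: if_splits)
  moreover have "[int C * int y ^ n = 1] (mod int u ^ n)"
    using sol_cong by (metis cong_int_iff of_nat_1 of_nat_mult of_nat_power)
  moreover have "int C dvd int h * int n" using sol_facts(13) by (metis of_nat_dvd_iff of_nat_mult)
  ultimately show False
    using scan_sound[of "int u" "int y" e b "int h" K n0 \<kappa> n "int C"] b n0 nK K1 rk sol_facts(1,6) by auto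
qed

lemma check_pair_sound:
  assumes c: "check_pair (int h) (int D) (int w) excl sk (int u) e b n0 (int y)"
    and ex: "\<And>p. p \<in> set excl \<Longrightarrow> \<not> p dvd int y"
    and sk: "sk \<Longrightarrow> y \<noteq> w + 1 \<and> w \<noteq> y + 1"
    and b: "barrett b" "fst b dvd int u ^ n" and n0: "nat_of_num n0 \<le> n"
  shows False
proof -
  have ne: "\<not> list_ex (\<lambda>p. int y mod p = 0) excl" using ex by (auto simp: list_ex_iff dvd_eq_mod_eq_0)
  consider "w < y" | "y < w" using y_ne_w by linarith
  then show False
  proof cases
    case 1
    have "\<not> (sk \<and> int y - int w = 1)" using sk by auto
    then have "scan_bound (int u) (int y) e b n0 (int h) (int D) (int 1) (int y - int w) (int y + int w)"
      using c ne 1 by (auto simp: check_pair_def)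
    moreover have "7 * y ^ n \<le> 8 * (1 * n) ^ D * w ^ n" using sol_above by simp
    ultimately show False using scan_bound_sound[of e b n0 D 1 y w] 1 w_pos b n0 by simp
  next
    case 2
    have "\<not> (sk \<and> int w - int y = 1)" using sk by auto
    then have "scan_bound (int u) (int y) e b n0 (int h) (int 1) (int h) (int w - int y) (int y + int w)"
      using c ne 2 by (auto simp: check_pair_def)
    moreover have "7 * w ^ n \<le> 8 * (h * n) ^ 1 * y ^ n" using sol_below by simp
    ultimately show False using scan_bound_sound[of e b n0 1 h w y] 2 sol_facts(2) b n0 rk by simp
  qed
qed

lemma check_range_sound:
  "check_range (int h) (int D) (int w) st excl sk (int u) e b n0 z x \<Longrightarrow> 0 < st \<Longrightarrow>
    x + st * int i \<le> z \<Longrightarrow> check_pair (int h) (int D) (int w) excl sk (int u) e b n0 (x + st * int i)"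
proof (induction i arbitrary: x)
  case 0
  then show ?case by (subst (asm) check_range.simps) (auto split: if_splits)
next
  case (Suc i)
  have "x \<le> x + st * int (Suc i)" using Suc.prems(2) by simp
  then have "\<not> z < x" using Suc.prems(3) by linarith
  then have "check_range (int h) (int D) (int w) st excl sk (int u) e b n0 z (x + st)"
    using Suc.prems(1,2) by (subst (asm) check_range.simps) auto
  moreover have e: "x + st * int (Suc i) = x + st + st * int i" by (simp add: algebra_simps)
  ultimately show ?case unfolding e using Suc.IH[of "x + st"] Suc.prems(2,3) e by simp
qed

lemma check_interval_sound:
  assumes c: "check_interval (int h) D (3 ^ D) st y0 excl sk (int u) (int w) e b n0 a z"
    and ex: "\<And>p. p \<in> set excl \<Longrightarrow> \<not> p dvd int y"
    and sk: "sk \<Longrightarrow> y \<noteq> w + 1 \<and> w \<noteq> y + 1"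
    and b: "barrett b" "fst b dvd int u ^ n" and n0: "nat_of_num n0 \<le> n"
    and st: "0 < st" "[int y = y0] (mod st)"
  shows False
proof -
  have cov: "3 * int h * a ^ 3 \<le> int w ^ 3" "8896 < int u * (z + 1) \<or> 8 * 3 ^ D * int w ^ 3 \<le> 7 * (z + 1) ^ 3"
    and rng: "check_range (int h) (int D) (int w) st excl sk (int u) e b n0 z (round_up y0 st (a + 1))"
    using c by (auto simp: check_interval_def covers_def)
  have "w ^ 3 < 3 * h * y ^ 3" using ratio_bound_below[OF sol_facts(3) sol_below] rk by simp
  then have "int (w ^ 3) < int (3 * h * y ^ 3)" by (simp only: of_nat_less_iff)
  then have "3 * int h * a ^ 3 < 3 * int h * int y ^ 3" using cov(1) by simp
  then have "a ^ 3 < int y ^ 3" using rk by simp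
  then have ay: "a < int y" using power_mono_odd[of 3 "int y" a] by fastforce
  have yz: "int y \<le> z"
  proof (rule ccontr)
    assume "\<not> int y \<le> z"
    then have zy: "z + 1 \<le> int y" by simp
    have "7 * y ^ 3 < 8 * 3 ^ D * w ^ 3" using ratio_bound_above[OF sol_facts(3) w_pos sol_above] .
    then have "int (7 * y ^ 3) < int (8 * 3 ^ D * w ^ 3)" by (simp only: of_nat_less_iff)
    then have "7 * int y ^ 3 < 8 * 3 ^ D * int w ^ 3" by simp
    moreover have "(z + 1) ^ 3 \<le> int y ^ 3" using zy by (intro power_mono_odd) auto
    moreover have "int u * (z + 1) \<le> int u * int y" using zy by (intro mult_left_mono) auto
    moreover have "int u * int y \<le> 8896" using sol_facts(9) by (metis of_nat_le_iff of_nat_mult of_nat_numeral)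
    ultimately show False using cov(2) by linarith
  qed
  define s where "s = round_up y0 st (a + 1)"
  define i where "i = (int y - (a + 1)) div st"
  have i0: "0 \<le> i" using ay st(1) by (simp add: i_def pos_imp_zdiv_nonneg_iff)
  have "(int y - (a + 1)) mod st = (y0 - (a + 1)) mod st"
    using st(2) cong_diff[OF st(2) cong_refl[of "a + 1"]] by (simp add: cong_def)
  then have "int y = s + st * i"
    using div_mult_mod_eq[of "int y - (a + 1)" st] by (simp add: s_def round_up_def i_def algebra_simps)
  then have yi: "int y = s + st * int (nat i)" using i0 by simp
  have "check_pair (int h) (int D) (int w) excl sk (int u) e b n0 (s + st * int (nat i))"
    using check_range_sound[OF rng st(1), of "nat i"] yi yz by (simp add: s_def)
  then show False using check_pair_sound[of excl sk e b n0] ex sk b n0 yi by simp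
qed

lemma check_small_sound:
  assumes c: "check_small r k (int h) adm (int u) n0" and n: "n < nat_of_num n0"
    and ad: "adm \<Longrightarrow> admissible r (int C)"
  shows False
proof -
  have "int n < int (nat_of_num n0)" using n by simp
  then have "int n \<le> Int.Pos n0 - 1" unfolding Pos_eq by simp
  then have cs: "check_small_n r k (int h) adm (int u) (int n)"
    using c sol_facts(3) by (auto simp: check_small_def list_all_iff)
  have mem: "int n1 \<in> set [1..int n]" using sol_facts(4,11) by simp
  have md: "int n mod int n1 = 0" using sol_facts(5) by (simp flip: zmod_int)
  have c1: "check_small_n1 r (int u) (int (h * (n div n1))) adm n (geom_int r (int ((n1 * u ^ n) ^ k)))"
    using bspec[OF cs[unfolded check_small_n_def list_all_iff] mem] md by (simp add: zdiv_int)
  obtain q where q: "n = n1 * q" using sol_facts(5) by blast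
  have "C * n1 dvd (h * q) * n1" using sol_facts(7) q by (simp add: mult_ac)
  then have Cd: "C dvd h * (n div n1)" using sol_facts(4) q by simp
  moreover have "0 < h * (n div n1)" using rk q sol_facts(3,4) by (cases q) auto
  ultimately have "C \<le> h * (n div n1)" by (rule dvd_imp_le)
  then have memC: "int C \<in> set [1..int (h * (n div n1))]" using sol_facts(6) by (simp only: set_upto atLeastAtMost_iff of_nat_le_iff) simp
  have mdC: "int (h * (n div n1)) mod int C = 0"
    using Cd by (simp only: of_nat_dvd_iff dvd_eq_mod_eq_0[symmetric])
  have "not_power (int u) (geom_int r (int ((n1 * u ^ n) ^ k))) (int C) n"
    using bspec[OF c1[unfolded check_small_n1_def list_all_iff] memC] mdC ad by (simp split: if_splits)
  then have "int C * int y ^ n \<noteq> int (geom r ((n1 * u ^ n) ^ k))" unfolding geom_int_eq using sol_facts(9) by (rule not_power_sound)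
  then show False using sol_facts(10) by (metis of_nat_mult of_nat_power)
qed

lemma bit_search_sound:
  "0 < M \<Longrightarrow> p = 2 ^ a \<Longrightarrow> barrett (bit_search M a p) \<and> fst (bit_search M a p) = M"
proof (induction M a p rule: bit_search.induct)
  case (1 M a p)
  show ?case
  proof (cases "M < 2 * p")
    case True
    then have "bit_search M a p = (M, a, 4 * p * p div M)" by (subst bit_search.simps) simp
    moreover have "4 * p * p div M * M \<le> 4 * p * p" using 1 by (intro div_mult_le) auto
    moreover have "0 \<le> 4 * p * p div M" using 1 by (simp add: pos_imp_zdiv_nonneg_iff)
    ultimately show ?thesis using 1 by (simp add: barrett_def)
  next
    case False
    then have "bit_search M a p = bit_search M (Suc a) (2 * p)" using 1 by (subst bit_search.simps) simp
    then show ?thesis using 1 False by simp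
  qed
qed

lemma check_u_sound:
  assumes c: "check_u r k (int h) adm st y0 excl (int u, g, e)"
    and ex: "\<And>p. p \<in> set excl \<Longrightarrow> \<not> p dvd int y"
    and ad: "adm \<Longrightarrow> admissible r (int C)"
    and sk: "\<not> adm \<Longrightarrow> 10 \<le> u \<Longrightarrow> y \<noteq> w + 1 \<and> w \<noteq> y + 1"
    and st: "0 < st" "[int y = y0] (mod st)"
  shows False
proof -
  define n0 where "n0 = (if num_of_nat e \<le> num.Bit1 num.One then num.Bit1 num.One else num_of_nat e)"
  define b where "b = bit_search (g ^ e) 0 1"
  have g: "1 < g" "0 < e" "g dvd int u"
    and cm: "check_mod r k (int h) adm st y0 excl (int u) (int u ^ D) (num_of_nat e) b n0"
    using c by (auto simp: check_u_def n0_def b_def D dvd_eq_mod_eq_0)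
  have b: "barrett b" "fst b = g ^ e" using bit_search_sound[of "g ^ e" 1 0] g by (auto simp: b_def)
  have e: "e \<le> nat_of_num n0" using g(2) by (auto simp: n0_def num_of_nat_inverse less_eq_num_def)
  have wi: "int u ^ D = int w" by (simp add: w)
  show False
  proof (cases "n < nat_of_num n0")
    case True
    then show ?thesis using check_small_sound[of adm n0] cm ad by (auto simp: check_mod_def)
  next
    case False
    have "g ^ e dvd int u ^ e" using g(3) by (rule dvd_power_same)
    also have "\<dots> dvd int u ^ n" using e False by (intro le_imp_power_dvd) auto
    finally have "fst b dvd int u ^ n" by (simp add: b)
    then show ?thesis
      using cm False b ex sk st unfolding check_mod_def wi D[symmetric]
      by (auto intro: check_interval_sound)
  qed
qed

end

section \<open>Reduction to one factor of prime length\<close>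

lemma split_equation:
  fixes b s n m :: nat
  assumes eq: "b * geom m b = n * s ^ n" and b: "b \<ge> 2" and m: "m \<ge> 1" and n: "n \<ge> 1"
  obtains n1 n2 u v where "b = n1 * u ^ n" "geom m b = n2 * v ^ n" "n = n1 * n2" "s = u * v"
proof -
  have pos: "0 < m" "0 < b" "0 < n" "0 < geom m b" using b m n geom_pos[of m b] by auto
  show ?thesis
    by (rule coprime_mult_eq_mult_power[OF coprime_geom[OF pos(1)] eq pos(2) pos(4) pos(3)]) (rule that)
qed

text \<open>Since \<open>geom m b \<ge> b ^ (m - 1)\<close>, the product \<open>b * geom m b\<close> is at least \<open>b ^ m\<close>, hence at least \<open>(u ^ n) ^ m\<close>.\<close>

lemma power_bound:
  fixes b s n m n1 u :: nat
  assumes eq: "b * geom m b = n * s ^ n" and b: "b = n1 * u ^ n" "n1 \<ge> 1" and m: "m \<ge> 1"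
  shows "(u ^ m) ^ n \<le> n * s ^ n"
proof -
  have "(u ^ m) ^ n = (u ^ n) ^ m" by (simp add: power_mult[symmetric] mult.commute)
  also have "\<dots> \<le> b ^ m" using b by (intro power_mono) auto
  also have "\<dots> = b * b ^ (m - 1)" using m by (cases m) auto
  also have "\<dots> \<le> b * geom m b" using geom_ge_power[where m = "m - 1" and b = b] m by simp
  finally show ?thesis using eq by simp
qed

lemma mult_two_power_le: "n \<ge> 3 \<Longrightarrow> n * 2 ^ n \<le> (3::nat) ^ n"
proof (induction n rule: nat_induct_at_least)
  case (Suc n)
  have "Suc n * 2 ^ Suc n = (2 * n + 2) * 2 ^ n" by (simp add: algebra_simps)
  also have "\<dots> \<le> (3 * n) * 2 ^ n" using Suc.hyps by (intro mult_right_mono) auto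
  also have "\<dots> \<le> 3 * 3 ^ n" using Suc.IH by simp
  finally show ?case by simp
qed simp

lemma u_power_bound:
  fixes u m n s :: nat
  assumes "(u ^ m) ^ n \<le> n * s ^ n" "n \<ge> 3" "s \<le> 8896"
  shows "u ^ m \<le> 13344"
proof -
  have "(2 * u ^ m) ^ n \<le> 2 ^ n * (n * s ^ n)" using assms(1) by (simp add: power_mult_distrib)
  also have "\<dots> = n * 2 ^ n * s ^ n" by simp
  also have "\<dots> \<le> 3 ^ n * 8896 ^ n"
    using mult_two_power_le[OF assms(2)] assms(3) by (intro mult_mono power_mono) auto
  also have "\<dots> = 26688 ^ n" by (simp add: power_mult_distrib[symmetric])
  finally have "2 * u ^ m \<le> 26688" using assms(2) by (subst (asm) power_mono_iff) auto
  then show ?thesis by simp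
qed

lemma cong_one_if_primes:
  fixes y M :: nat
  assumes "y > 0" "\<And>p. prime p \<Longrightarrow> p dvd y \<Longrightarrow> [p = 1] (mod M)"
  shows "[y = 1] (mod M)"
proof -
  have "y = prod_mset (prime_factorization y)" using assms(1) by (simp add: prod_mset_prime_factorization_nat)
  moreover have "[prod_mset A = 1] (mod M)" if "\<And>p. p \<in># A \<Longrightarrow> [p = 1] (mod M)" for A :: "nat multiset"
    using that
  proof (induction A)
    case (add x A)
    then have "[x * prod_mset A = 1 * 1] (mod M)" by (intro cong_mult) auto
    then show ?case by simp
  qed simp
  ultimately show ?thesis using assms(2) by (metis in_prime_factors_iff)
qed

text \<open>A prime common to \<open>A = geom \<rho> (b ^ k)\<close> and its cofactor can only be \<open>\<rho>\<close>, and it divides \<open>A\<close> at most once. Moving that one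
factor to the cofactor makes the two parts coprime, so each of them is a divisor of \<open>n2\<close> times an \<open>n\<close>-th power.\<close>

lemma extract_factor:
  fixes m b n2 v n \<rho> k :: nat
  assumes eq: "geom m b = n2 * v ^ n" and b: "b \<ge> 2" and n: "n \<ge> 1" and m: "m = k * \<rho> * t" "m \<ge> 1"
    and \<rho>: "prime \<rho>" "\<And>q. prime q \<Longrightarrow> q dvd m \<Longrightarrow> q \<le> \<rho>"
    and sq: "\<not> \<rho> ^ 2 dvd geom \<rho> (b ^ k)"
  obtains C y where "geom \<rho> (b ^ k) = C * y ^ n" "C dvd \<rho> * n2" "y dvd v" "\<not> \<rho> dvd y"
    "\<And>p. prime p \<Longrightarrow> p dvd y \<Longrightarrow> \<rho> dvd p - 1"
proof -
  define A where "A = geom \<rho> (b ^ k)"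
  define B where "B = geom k b * geom t (b ^ (k * \<rho>))"
  have AB: "A * B = n2 * v ^ n" unfolding eq[symmetric] m(1) geom_mult A_def B_def by (simp only: mult_ac)
  have t: "t > 0" using m by (cases t) auto
  have A: "A > 0" unfolding A_def using \<rho>(1) by (intro geom_pos prime_gt_0_nat)
  have "geom m b > 0" using m(2) by (intro geom_pos) simp
  then have B: "B > 0" using AB eq by (cases B) auto
  have co: "p = \<rho>" if "prime p" "p dvd A" "p dvd B" for p
    using prime_dvd_cofactor[OF that(1) \<rho>(1), of b t k] that t \<rho>(2) m b by (auto simp: A_def B_def)
  have pr: "p = \<rho> \<or> \<rho> dvd p - 1" if "prime p" "p dvd A" for p
    using prime_dvd_geom_prime[OF that(1) \<rho>(1), of "b ^ k"] that b by (auto simp: A_def)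
  show ?thesis
  proof (cases "\<rho> dvd A")
    case False
    have "coprime A B"
    proof (rule ccontr)
      assume "\<not> coprime A B"
      then obtain p where "prime p" "p dvd A" "p dvd B" using not_coprime_imp_prime by blast
      then show False using co False by blast
    qed
    then obtain c1 c2 y z where c: "A = c1 * y ^ n" "n2 = c1 * c2" "v = y * z"
      using coprime_mult_eq_mult_power[OF _ AB A B] n by (metis less_le_trans zero_less_one)
    have yA: "y dvd A" using c(1) n by (simp add: dvd_mult dvd_power)
    show ?thesis
    proof (rule that[of c1 y])
      show "geom \<rho> (b ^ k) = c1 * y ^ n" using c(1) by (simp add: A_def)
      show "c1 dvd \<rho> * n2" "y dvd v" using c by simp_all
      show "\<not> \<rho> dvd y" using False yA dvd_trans by blast
      show "\<rho> dvd p - 1" if "prime p" "p dvd y" for p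
      proof -
        have "p dvd A" using that(2) yA by (rule dvd_trans)
        moreover have "p \<noteq> \<rho>" using False calculation by blast
        ultimately show ?thesis using pr[OF that(1)] by blast
      qed
    qed
  next
    case True
    then obtain A' where A': "A = \<rho> * A'" by blast
    have nd: "\<not> \<rho> dvd A'" using sq A' by (auto simp: A_def power2_eq_square)
    \<comment> \<open>Here \<open>A = \<rho> * A'\<close>, and the factor \<open>\<rho>\<close> is moved to \<open>B\<close>.\<close>
    have "coprime A' (\<rho> * B)"
    proof (rule ccontr)
      assume "\<not> coprime A' (\<rho> * B)"
      then obtain p where p: "prime p" "p dvd A'" "p dvd \<rho> * B" using not_coprime_imp_prime by blast
      have "p \<noteq> \<rho>" using p nd by blast
      then have "\<not> p dvd \<rho>" using primes_dvd_imp_eq[OF p(1) \<rho>(1)] by blast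
      then have "p dvd B" using p by (simp add: prime_dvd_mult_iff)
      then show False using co[OF p(1)] p A' \<open>p \<noteq> \<rho>\<close> by simp
    qed
    moreover have "A' * (\<rho> * B) = n2 * v ^ n" using AB A' by (simp add: mult_ac)
    moreover have "A' > 0" "\<rho> * B > 0" using A A' B by auto
    ultimately obtain c1 c2 y z where c: "A' = c1 * y ^ n" "n2 = c1 * c2" "v = y * z"
      using coprime_mult_eq_mult_power[of A' "\<rho> * B" n2 v n] n by (metis less_le_trans zero_less_one)
    have yA: "y dvd A'" using c(1) n by (simp add: dvd_mult dvd_power)
    show ?thesis
    proof (rule that[of "\<rho> * c1" y])
      show "geom \<rho> (b ^ k) = \<rho> * c1 * y ^ n" using c(1) A' by (simp add: A_def)
      show "\<rho> * c1 dvd \<rho> * n2" "y dvd v" using c by simp_all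
      show "\<not> \<rho> dvd y" using nd yA dvd_trans by blast
      show "\<rho> dvd p - 1" if "prime p" "p dvd y" for p
      proof -
        have "p dvd A'" using that(2) yA by (rule dvd_trans)
        moreover have "p \<noteq> \<rho>" using nd calculation by blast
        ultimately show ?thesis using pr[OF that(1)] A' by simp
      qed
    qed
  qed
qed

text \<open>Otherwise \<open>geom \<rho> (b ^ k)\<close> would divide \<open>\<rho> n2\<close>, but it exceeds \<open>2 ^ (n * (\<rho> - 1))\<close>.\<close>

lemma y_at_least_two:
  assumes eq: "geom \<rho> (b ^ k) = C * y ^ n" and C: "C dvd \<rho> * n2" "0 < n2" "n2 \<le> n" and \<rho>: "\<rho> \<ge> 2"
    and b: "b \<ge> 2 ^ n" and k: "k \<ge> 1"
  shows "y \<ge> 2"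
proof (rule ccontr)
  assume "\<not> y \<ge> 2"
  then have "y \<le> 1" by simp
  then have y: "y ^ n \<le> 1" using power_mono[of y 1 n] by simp
  have "b ^ 1 \<le> b ^ k" using b k by (intro power_increasing) (auto intro: order.trans[rotated])
  then have T: "2 ^ n \<le> b ^ k" using b by simp
  obtain j where j: "\<rho> = Suc (Suc j)" using \<rho> by (metis Suc_le_D numeral_2_eq_2 Suc_le_mono)
  have "n \<le> 2 ^ (n - 1)" using less_exp[of "n - 1"] by linarith
  then have "\<rho> * n \<le> 2 ^ (\<rho> - 1) * 2 ^ (n - 1)"
    using le_two_power_pred[of \<rho>] \<rho> by (intro mult_mono) auto
  also have "\<dots> = 2 ^ (Suc j + (n - 1))" by (simp add: power_add j)
  also have "\<dots> \<le> 2 ^ (n * Suc j)" if "n \<ge> 1" using that by (intro power_increasing) (cases n, auto)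
  also have "2 ^ (n * Suc j) \<le> (b ^ k) ^ Suc j"
    using power_mono[OF T, of "Suc j"] by (simp only: power_mult)
  also have "\<dots> < geom \<rho> (b ^ k)" using geom_pos[of "Suc j" "b ^ k"] by (simp add: j geom_Suc_top)
  also have "\<dots> \<le> C" using eq y mult_le_mono2[OF y, of C] by simp
  also have "C \<le> \<rho> * n2" using C \<rho> by (intro dvd_imp_le) auto
  also have "\<dots> \<le> \<rho> * n" using C by simp
  finally show False using C by simp
qed

lemma odd_geom: "odd \<rho> \<Longrightarrow> odd (geom \<rho> T)"
proof (cases "even T")
  case True
  assume "odd \<rho>"
  then obtain j where "\<rho> = Suc j" using odd_pos gr0_implies_Suc by blast
  with True show ?thesis by (simp add: geom_Suc)
next
  case False
  assume o: "odd \<rho>"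
  have "[T = 1] (mod 2)" using False by (simp add: cong_def odd_iff_mod_2_eq_one)
  then have "[geom \<rho> T = \<rho>] (mod 2)" by (rule geom_cong_one)
  with o show ?thesis by (simp add: cong_def odd_iff_mod_2_eq_one)
qed

text \<open>By Fermat, \<open>(T - 1) * geom \<rho> T = T ^ \<rho> - 1\<close> is \<open>T - 1\<close> modulo \<open>\<rho>\<close>.\<close>

lemma geom_prime_mod:
  assumes "prime \<rho>" "T \<ge> 1" shows "geom \<rho> T mod \<rho> = 0 \<or> geom \<rho> T mod \<rho> = 1"
proof (cases "[T = 1] (mod \<rho>)")
  case True
  then show ?thesis using geom_cong_one[OF True, of \<rho>] by (simp add: cong_def)
next
  case False
  have "[(T - 1) * geom \<rho> T + 1 = T] (mod \<rho>)" using geom_geometric[of T \<rho>] assms fermat_cong[of \<rho> T] by simp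
  moreover have "T = (T - 1) * 1 + 1" using assms by simp
  ultimately have "[(T - 1) * geom \<rho> T + 1 = (T - 1) * 1 + 1] (mod \<rho>)" by metis
  then have "[(T - 1) * geom \<rho> T = (T - 1) * 1] (mod \<rho>)" using cong_add_rcancel_nat by blast
  moreover have "\<not> \<rho> dvd T - 1" using False assms cong_altdef_nat[of 1 T \<rho>] cong_sym by blast
  then have "coprime (T - 1) \<rho>" using assms(1) by (simp add: prime_imp_coprime coprime_commute)
  ultimately have "[geom \<rho> T = 1] (mod \<rho>)" using cong_mult_lcancel_nat by blast
  then show ?thesis using prime_gt_1_nat[OF assms(1)] by (simp add: cong_def)
qed

lemma admissible_odd:
  assumes \<rho>: "prime \<rho>" "odd \<rho>" and T: "T \<ge> 1" and eq: "geom \<rho> T = C * y ^ n"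
    and y: "[y = 1] (mod \<rho>)"
  shows "admissible \<rho> (int C)"
proof -
  have "odd (C * y ^ n)" using odd_geom[OF \<rho>(2), of T] eq by simp
  then have oC: "odd C" by simp
  have "[C * y ^ n = C * 1 ^ n] (mod \<rho>)" using y by (intro cong_mult cong_pow) auto
  then have "C mod \<rho> = 0 \<or> C mod \<rho> = 1" using geom_prime_mod[OF \<rho>(1) T] eq by (simp add: cong_def)
  moreover have "C mod (2 * \<rho>) mod \<rho> = C mod \<rho>" by (simp add: mod_mod_cancel)
  moreover have "odd (C mod (2 * \<rho>))" using oC by (simp add: dvd_mod_iff)
  moreover have "C mod (2 * \<rho>) < 2 * \<rho>" using prime_gt_0_nat[OF \<rho>(1)] by simp
  ultimately have "C mod (2 * \<rho>) = 1 \<or> C mod (2 * \<rho>) = \<rho>"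
  proof -
    define x where "x = C mod (2 * \<rho>)"
    have x: "odd x" "x < 2 * \<rho>" "x mod \<rho> = 0 \<or> x mod \<rho> = 1"
      using \<open>odd (C mod (2 * \<rho>))\<close> \<open>C mod (2 * \<rho>) < 2 * \<rho>\<close> \<open>C mod \<rho> = 0 \<or> C mod \<rho> = 1\<close>
        \<open>C mod (2 * \<rho>) mod \<rho> = C mod \<rho>\<close> by (auto simp: x_def)
    show ?thesis
    proof (cases "x < \<rho>")
      case True
      then show ?thesis using x by (auto simp: x_def)
    next
      case False
      then have "x mod \<rho> = x - \<rho>" using x(2) by (simp add: le_mod_geq)
      then have "x = \<rho> \<or> x = \<rho> + 1" using x(3) False by auto
      then show ?thesis using x(1) \<rho>(2) by (auto simp: x_def)
    qed
  qed
  moreover have "\<rho> \<noteq> 2" using \<rho>(2) by auto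
  moreover have "int C mod (2 * int \<rho>) = int (C mod (2 * \<rho>))" by (simp add: zmod_int)
  ultimately show ?thesis by (auto simp: admissible_def)
qed

text \<open>The order of \<open>b\<close> modulo \<open>p\<close> is \<open>4\<close>, because \<open>b\<^sup>2\<close> is \<open>-1\<close>.\<close>

lemma mod_four_square_plus:
  fixes p b :: nat
  assumes "p dvd b ^ 2 + 1" "prime p" "p \<noteq> 2" shows "[p = 1] (mod 4)"
proof -
  have c: "[b ^ 4 = 1] (mod p)"
  proof -
    have e: "(b ^ 2 - 1) * (b ^ 2 + 1) + 1 = b ^ 4" if "b \<ge> 1"
    proof -
      define a where "a = b ^ 2 - 1"
      have "1 \<le> b ^ 2" using that by simp
      then have a: "b ^ 2 = a + 1" by (simp add: a_def)
      have "b ^ 4 = (b ^ 2) ^ 2" by simp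
      then show ?thesis unfolding a by (simp add: power2_eq_square algebra_simps)
    qed
    have "b \<noteq> 0"
    proof
      assume "b = 0"
      then have "p dvd 1" using assms(1) by simp
      then show False using assms(2) by simp
    qed
    then have "(b ^ 2 - 1) * (b ^ 2 + 1) + 1 = b ^ 4" by (intro e) simp
    moreover have "[(b ^ 2 - 1) * (b ^ 2 + 1) = 0] (mod p)"
      unfolding cong_0_iff using assms(1) by (rule dvd_mult)
    then have "[(b ^ 2 - 1) * (b ^ 2 + 1) + 1 = 0 + 1] (mod p)" by (rule cong_add) (rule cong_refl)
    ultimately show ?thesis by (simp only: add_0)
  qed
  have n2: "\<not> [b ^ 2 = 1] (mod p)"
  proof
    assume "[b ^ 2 = 1] (mod p)"
    then have c2: "[b ^ 2 + 1 = 1 + 1] (mod p)" by (rule cong_add) (rule cong_refl)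
    have "p dvd 2" using cong_dvd_iff[OF c2] assms(1) by (simp add: numeral_2_eq_2)
    then show False using primes_dvd_imp_eq[OF assms(2) two_is_prime_nat] assms(3) by blast
  qed
  have "\<not> p dvd b"
  proof
    assume "p dvd b"
    then have "p dvd b ^ 2" by (simp add: power2_eq_square)
    then have "p dvd 1" using assms(1) dvd_add_right_iff by blast
    then show False using assms(2) by simp
  qed
  then have cop: "coprime p b" using assms(2) by (simp add: prime_imp_coprime)
  have d4: "ord p b dvd 4" using c ord_divides by blast
  have d2: "\<not> ord p b dvd 2" using n2 ord_divides by blast
  have aux: "d = 4" if "d \<le> 4" "d \<noteq> 0" "d \<noteq> 1" "d \<noteq> 2" "d \<noteq> 3" for d :: nat
    using that by linarith
  have o: "ord p b = 4"
  proof (rule aux)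
    show "ord p b \<le> 4" using d4 by (rule dvd_imp_le) simp
    show "ord p b \<noteq> 0" using cop by simp
    show "ord p b \<noteq> 1" using d2 by (metis one_dvd)
    show "ord p b \<noteq> 2" using d2 by (metis dvd_refl)
    show "ord p b \<noteq> 3"
    proof
      assume "ord p b = 3"
      then have "(3::nat) dvd 4" using d4 by metis
      then show False by simp
    qed
  qed
  have "4 dvd p - 1" using order_divides_totient[of p b] cop o assms(2) by (simp add: totient_prime)
  then show ?thesis using prime_gt_1_nat[OF assms(2)] cong_altdef_nat[of 1 p 4] cong_sym by auto
qed

section \<open>Neighbouring bases\<close>

lemma succ_power_ge: "2 * u ^ u \<le> (u + 1) ^ u" if "u \<ge> 1" for u :: nat
proof -
  have "real (2 * u ^ u) \<le> real ((u + 1) ^ u)"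
  proof -
    have "- 1 \<le> 1 / real u" using divide_nonneg_nonneg[of 1 "real u"] by linarith
    then have "1 + real u * (1 / real u) \<le> (1 + 1 / real u) ^ u" by (rule Bernoulli_inequality)
    then have "2 \<le> (1 + 1 / real u) ^ u" using that by simp
    also have "1 + 1 / real u = (real u + 1) / real u" using that by (simp add: field_simps)
    finally show ?thesis using that by (simp add: power_divide field_simps)
  qed
  then show ?thesis by (simp only: of_nat_le_iff)
qed

lemma succ_power_le: "(u + 1) ^ u \<le> 3 * u ^ u" if "u \<ge> 1" for u :: nat
proof -
  have "(1 + 1 / real u) ^ u \<le> exp (1 / real u) ^ u"
    by (intro power_mono exp_ge_add_one_self) (use that in auto)
  also have "\<dots> = exp 1" using exp_of_nat_mult[of u "1 / real u"] that by simp
  also have "\<dots> \<le> 3" by (rule exp_le)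
  also have "1 + 1 / real u = (real u + 1) / real u" using that by (simp add: field_simps)
  finally have "real ((u + 1) ^ u) \<le> real (3 * u ^ u)" using that by (simp add: power_divide field_simps)
  then show ?thesis by (simp only: of_nat_le_iff)
qed

text \<open>By Bernoulli, \<open>(1 + 1/u) ^ u\<close> is at least \<open>2\<close>.\<close>

lemma succ_power_div: "u \<ge> 1 \<Longrightarrow> 2 ^ (n div u) * u ^ n \<le> (u + 1) ^ n" for u :: nat
proof -
  assume u: "u \<ge> 1"
  have "n = u * (n div u) + n mod u" by simp
  then have e: "x ^ n = (x ^ u) ^ (n div u) * x ^ (n mod u)" for x :: nat
    by (metis power_add power_mult)
  have "2 ^ (n div u) * u ^ n = (2 * u ^ u) ^ (n div u) * u ^ (n mod u)"
    by (subst e) (simp add: power_mult_distrib)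
  also have "\<dots> \<le> ((u + 1) ^ u) ^ (n div u) * (u + 1) ^ (n mod u)"
    using succ_power_ge[OF u] by (intro mult_mono power_mono) auto
  also have "\<dots> = (u + 1) ^ n" by (rule e[symmetric])
  finally show ?thesis .
qed

lemma exp_beats_quadratic: "t \<ge> 6 \<Longrightarrow> 8 * t * (t + 1) < 7 * 2 ^ t" for t :: nat
proof (induction t rule: nat_induct_at_least)
  case (Suc t)
  obtain s where s: "t = s + 6" using Suc.hyps by (metis add.commute le_Suc_ex)
  have "8 * Suc t * (Suc t + 1) \<le> 2 * (8 * t * (t + 1))" unfolding s by (simp add: algebra_simps)
  with Suc.IH show ?case by simp
qed simp

lemma exp_beats_square: "t \<ge> 6 \<Longrightarrow> (t + 1) ^ 2 < 2 ^ t" for t :: nat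
proof (induction t rule: nat_induct_at_least)
  case (Suc t)
  obtain s where s: "t = s + 6" using Suc.hyps by (metis add.commute le_Suc_ex)
  have "(Suc t + 1) ^ 2 \<le> 2 * (t + 1) ^ 2" unfolding s by (simp add: algebra_simps power2_eq_square)
  with Suc.IH show ?case by simp
qed simp

text \<open>Modulo \<open>u\<close> and \<open>v = u + 1\<close> the equation gives \<open>n2 \<equiv> 1\<close> and \<open>n1 \<equiv> \<plusminus>1\<close>. If \<open>n2 \<noteq> 1\<close> then both numbers are at least \<open>u\<close>. If
\<open>n2 = 1\<close>, then \<open>n\<close> is a multiple of \<open>u\<close> by the equation modulo \<open>u\<^sup>2\<close>, and its residue modulo \<open>v\<close> leaves \<open>n = u\<close>,
which \<open>(1 + 1/u) ^ u \<le> 3\<close> excludes, or \<open>n \<ge> u\<^sup>2\<close>.\<close>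

lemma not_consecutive_above:
  fixes u n n1 n2 :: nat
  assumes eq: "n2 * (u + 1) ^ n = n1 * u ^ n + 1" and n: "n = n1 * n2" "n \<ge> 3" and u: "u \<ge> 10"
  shows False
proof -
  define v where "v = u + 1"
  have n12: "n1 \<ge> 1" "n2 \<ge> 1" using n by (cases n1; cases n2; simp)+
  have n12': "n1 \<le> n" "n2 \<le> n"
    using n(1) n12 mult_le_mono2[of 1 n2 n1] mult_le_mono1[of 1 n1 n2] by auto
  have "int (n2 * v ^ n) = int (n1 * u ^ n + 1)" using eq by (simp add: v_def)
  then have eqi: "int n2 * int v ^ n = int n1 * int u ^ n + 1" by simp
  have dn: "x dvd y * x ^ n" for x y :: int using n(2) by (intro dvd_mult dvd_power) auto
  have up: "int u dvd int n1 * int u ^ n" by (rule dn)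
  have "[int v = 1] (mod int u)" by (simp add: v_def cong_iff_dvd_diff)
  then have "[int n2 * int v ^ n = int n2 * 1 ^ n] (mod int u)" by (intro cong_mult cong_pow) auto
  moreover have "[int n2 * int v ^ n = 0 + 1] (mod int u)"
    unfolding eqi using up by (intro cong_add) (auto simp: cong_0_iff)
  ultimately have "[int n2 * 1 ^ n = 0 + 1] (mod int u)" using cong_sym cong_trans by blast
  then have "[int n2 = 1] (mod int u)" by simp
  then have n2u: "int u dvd int n2 - 1" by (simp add: cong_iff_dvd_diff)
  have "[int u = - 1] (mod int v)" by (simp add: v_def cong_iff_dvd_diff add.commute)
  then have "[int n1 * int u ^ n + 1 = int n1 * (-1) ^ n + 1] (mod int v)" by (intro cong_add cong_mult cong_pow) auto
  moreover have "[int n1 * int u ^ n + 1 = 0] (mod int v)"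
    unfolding eqi[symmetric] cong_0_iff by (rule dn)
  ultimately have "[int n1 * (-1) ^ n + 1 = 0] (mod int v)" using cong_sym cong_trans by blast
  then have "int v dvd int n1 * (-1) ^ n + 1" by (simp only: cong_0_iff)
  then have n1v: "int v dvd int n1 + 1 \<or> int v dvd int n1 - 1"
  proof (cases "even n")
    case False
    then have "int v dvd - (int n1 - 1)" using \<open>int v dvd int n1 * (-1) ^ n + 1\<close> by simp
    then show ?thesis by (simp only: dvd_minus_iff) simp
  qed simp
  have up8: "7 * v ^ n < 8 * n * u ^ n"
  proof -
    have un: "8 \<le> u ^ n"
    proof -
      have "8 \<le> u ^ 1" using u by simp
      also have "\<dots> \<le> u ^ n" using u n(2) by (intro power_increasing) auto
      finally show ?thesis .
    qed
    have "7 * v ^ n \<le> 7 * (n2 * v ^ n)" using n12 by simp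
    also have "\<dots> = 7 * n1 * u ^ n + 7" using eq by (simp add: v_def)
    also have "\<dots> < 7 * n1 * u ^ n + u ^ n" using un by simp
    also have "\<dots> \<le> 8 * n1 * u ^ n" using n12 by simp
    also have "\<dots> \<le> 8 * n * u ^ n" using n12' by simp
    finally show ?thesis .
  qed
  have big: "n \<ge> u * u"
  proof (cases "n2 = 1")
    case False
    then have "int u \<le> int n2 - 1" using n2u n12 by (intro zdvd_imp_le) auto
    then have a: "u \<le> n2" by simp
    have "n1 \<noteq> 1"
    proof
      assume "n1 = 1"
      then have "n2 * v ^ n \<le> v ^ n" using eq power_strict_mono[of u v n] n by (simp add: v_def)
      then show False using False n12 by (simp add: v_def)
    qed
    then have "int v \<le> int n1 + 1" using n1v n12 by (auto dest!: zdvd_imp_le)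
    then have "u \<le> n1" by (simp add: v_def)
    then show ?thesis using a n(1) by (metis mult_le_mono)
  next
    case True
    then have n1: "n1 = n" using n by simp
    have "[v ^ n = 1 + u * n] (mod u ^ 2)"
    proof (induction n)
      case (Suc i)
      have "[v * v ^ i = (1 + u) * (1 + u * i)] (mod u ^ 2)"
        using Suc by (intro cong_mult) (auto simp: v_def)
      also have "(1 + u) * (1 + u * i) = 1 + u * Suc i + u ^ 2 * i" by (simp add: algebra_simps power2_eq_square)
      also have "[\<dots> = 1 + u * Suc i + 0] (mod u ^ 2)" by (intro cong_add) (auto simp: cong_0_iff)
      finally show ?case by simp
    qed simp
    moreover have "v ^ n = n * u ^ n + 1" using eq True n1 by (simp add: v_def)
    moreover have "u ^ 2 dvd n * u ^ n" using n(2) by (intro dvd_mult le_imp_power_dvd) auto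
    then have "[n * u ^ n + 1 = 0 + 1] (mod u ^ 2)" by (intro cong_add) (auto simp: cong_0_iff)
    ultimately have "[1 + u * n = 1 + 0] (mod u ^ 2)" by (simp add: cong_def)
    then have "u ^ 2 dvd u * n" using cong_add_lcancel_nat cong_0_iff by blast
    then have "u dvd n" using u by (simp add: power2_eq_square)
    then obtain j where j: "n = u * j" by blast
    have j1: "j \<ge> 1" using j n(2) by (cases j) auto
    have "j \<noteq> 1"
    proof
      assume "j = 1"
      then have nu: "n = u" using j by simp
      have "n * u ^ n + 1 = v ^ n" using \<open>v ^ n = n * u ^ n + 1\<close> by simp
      also have "\<dots> \<le> 3 * u ^ n" using succ_power_le[of u] u nu by (simp add: v_def)
      also have "\<dots> \<le> n * u ^ n" using n(2) by simp
      finally show False by simp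
    qed
    have "int n = int v * int j - int j" by (simp add: j v_def algebra_simps)
    then have "int n + 1 = int v * int j - (int j - 1)" "int n - 1 = int v * int j - (int j + 1)" by auto
    then have "int v dvd int j - 1 \<or> int v dvd int j + 1"
      using n1v n1 by (metis dvd_diff_right_iff dvd_triv_left)
    then have "int v \<le> int j + 1" using j1 \<open>j \<noteq> 1\<close> by (auto dest!: zdvd_imp_le)
    then have "u \<le> j" by (simp add: v_def)
    then show ?thesis using j by simp
  qed
  define t where "t = n div u"
  have t: "t \<ge> u" using div_le_mono[OF big, of u] u by (simp add: t_def)
  have "n < (t + 1) * u" using dividend_less_div_times[of u n] u by (simp add: t_def algebra_simps)
  have "7 * 2 ^ t * u ^ n \<le> 7 * v ^ n" using succ_power_div[of u n] u by (simp add: t_def v_def)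
  also have "\<dots> < 8 * n * u ^ n" by (rule up8)
  finally have "7 * 2 ^ t < 8 * n" by simp
  also have "\<dots> \<le> 8 * ((t + 1) * t)"
    using \<open>n < (t + 1) * u\<close> t mult_le_mono2[OF t, of "t + 1"] by linarith
  finally show False using exp_beats_quadratic[of t] t u by (simp add: algebra_simps)
qed

text \<open>Here \<open>n1 \<equiv> -1\<close> modulo \<open>v\<close> and \<open>n2 \<equiv> \<plusminus>1\<close> modulo \<open>u = v + 1\<close>, and \<open>n2 = 1\<close> is impossible because \<open>v < u\<close>.\<close>

lemma not_consecutive_below:
  fixes v n n1 n2 :: nat
  assumes eq: "n2 * v ^ n = n1 * (v + 1) ^ n + 1" and n: "n = n1 * n2" "n \<ge> 3" and v: "v \<ge> 9"
  shows False
proof -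
  define u where "u = v + 1"
  have n12: "n1 \<ge> 1" "n2 \<ge> 1" using n by (cases n1; cases n2; simp)+
  have n12': "n1 \<le> n" "n2 \<le> n"
    using n(1) n12 mult_le_mono2[of 1 n2 n1] mult_le_mono1[of 1 n1 n2] by auto
  have "int (n2 * v ^ n) = int (n1 * u ^ n + 1)" using eq by (simp add: u_def)
  then have eqi: "int n2 * int v ^ n = int n1 * int u ^ n + 1" by simp
  have dn: "x dvd y * x ^ n" for x y :: int using n(2) by (intro dvd_mult dvd_power) auto
  have "[int u = 1] (mod int v)" by (simp add: u_def cong_iff_dvd_diff)
  then have "[int n1 * int u ^ n + 1 = int n1 * 1 ^ n + 1] (mod int v)" by (intro cong_add cong_mult cong_pow) auto
  moreover have "[int n1 * int u ^ n + 1 = 0] (mod int v)"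
    unfolding eqi[symmetric] cong_0_iff by (rule dn)
  ultimately have "[int n1 * 1 ^ n + 1 = 0] (mod int v)" using cong_sym cong_trans by blast
  then have "int v dvd int n1 + 1" by (simp add: cong_0_iff)
  then have "int v \<le> int n1 + 1" by (intro zdvd_imp_le) auto
  then have n1: "v \<le> n1 + 1" by simp
  have "[int v = - 1] (mod int u)" by (simp add: u_def cong_iff_dvd_diff add.commute)
  then have "[int n2 * int v ^ n = int n2 * (- 1) ^ n] (mod int u)" by (intro cong_mult cong_pow) auto
  moreover have "[int n2 * int v ^ n = 0 + 1] (mod int u)"
    unfolding eqi using dn by (intro cong_add) (auto simp: cong_0_iff)
  ultimately have "[int n2 * (- 1) ^ n = 0 + 1] (mod int u)" using cong_sym cong_trans by blast
  then have "[int n2 * (- 1) ^ n = 1] (mod int u)" by simp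
  then have "int u dvd int n2 * (- 1) ^ n - 1" by (simp add: cong_iff_dvd_diff)
  then have "int u dvd int n2 - 1 \<or> int u dvd int n2 + 1"
  proof (cases "even n")
    case False
    then have "int u dvd - (int n2 + 1)" using \<open>int u dvd int n2 * (- 1) ^ n - 1\<close> by simp
    then show ?thesis by (simp only: dvd_minus_iff) simp
  qed simp
  moreover have "n2 \<noteq> 1"
  proof
    assume "n2 = 1"
    then have "n1 * u ^ n < v ^ n" using eq by (simp add: u_def)
    moreover have "1 * v ^ n \<le> n1 * u ^ n" using n12 by (intro mult_mono power_mono) (auto simp: u_def)
    ultimately show False by simp
  qed
  ultimately have "int u \<le> int n2 + 1" using n12 by (auto dest!: zdvd_imp_le)
  then have n2: "v \<le> n2" by (simp add: u_def)
  define t where "t = n div v"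
  have "v * (v - 1) \<le> n2 * n1" using n1 n2 by (intro mult_le_mono) auto
  then have "v * (v - 1) div v \<le> n div v" using n(1) by (intro div_le_mono) (simp add: mult.commute)
  then have t: "v \<le> t + 1" using v by (simp add: t_def)
  have nt: "n < (t + 1) * v" using dividend_less_div_times[of v n] v by (simp add: t_def algebra_simps)
  have "2 ^ t * v ^ n \<le> u ^ n" using succ_power_div[of v n] v by (simp add: t_def u_def)
  also have "\<dots> \<le> n1 * u ^ n" using n12 by simp
  also have "\<dots> < n2 * v ^ n" using eq by (simp add: u_def)
  also have "\<dots> \<le> n * v ^ n" using n12' by simp
  finally have "2 ^ t < n" by simp
  also have "\<dots> < (t + 1) * (t + 1)" using nt mult_le_mono2[OF t, of "t + 1"] by linarith
  finally show False using exp_beats_square[of t] t v by (simp add: power2_eq_square)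
qed

section \<open>Results of the search\<close>

text \<open>The case \<open>m = 2\<close>, where \<open>n2 v\<^sup>n = n1 u\<^sup>n + 1\<close>. For even \<open>u\<close> only odd \<open>v\<close> have to be visited.\<close>

definition check_linear :: "nat \<Rightarrow> int \<Rightarrow> bool" where
  "check_linear e u \<longleftrightarrow> (if u mod 2 = 0 then check_u 2 1 1 False 2 3 [] (u, u, e) else check_u 2 1 1 False 1 2 [] (u, u, e))"

text \<open>The case \<open>n = 2\<close>, with \<open>b = u\<^sup>2\<close> or \<open>b = 2 u\<^sup>2\<close>. The bound comes from \<open>(u ^ m)\<^sup>2 \<le> 2 \<cdot> 8896\<^sup>2\<close>.\<close>

definition check_square :: "nat \<Rightarrow> int \<Rightarrow> bool" where
  "check_square m u \<longleftrightarrow> (if 12581 < u ^ m then True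
     else not_power u (geom_int m (u ^ 2)) 2 2 \<and> not_power u (geom_int m (2 * u ^ 2)) 1 2)"

text \<open>The exponents \<open>e\<close> in the tables balance the cost of a step, which grows with the modulus, against the number of
accidental candidates. A proper divisor \<open>g\<close> of \<open>u\<close> is chosen where a power of two makes the reduction cheaper.\<close>

lemma squares_checked: "list_all (\<lambda>m. list_all (check_square m) [2..23]) [3, 4, 5, 6, 7, 8, 9, 10, 11, 12, 13]"
  by code_simp

lemma linear_2: "check_linear 6 2" by code_simp

lemma linear_3_6: "list_all (check_linear 4) [3..6]" by code_simp

lemma linear_7_33: "list_all (check_linear 3) [7..33]" by code_simp

lemma linear_34_60: "list_all (check_linear 2) [34..60]" by code_simp

lemma linear_61_75: "list_all (check_linear 2) [61..75]" by code_simp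

lemma linear_76_88: "list_all (check_linear 2) [76..88]" by code_simp

lemma linear_89_113: "list_all (check_linear 2) [89..113]" by code_simp

text \<open>For \<open>m = 4\<close> and \<open>m = 8\<close> the factor \<open>b\<^sup>2 + 1\<close> is used; the listed primes are \<open>3\<close> modulo \<open>4\<close>.\<close>

lemma quartic_checked: "list_all (check_u 2 2 2 True 4 5 [3, 7, 11])
  [(2, 2, 7), (3, 3, 4), (4, 4, 6), (5, 5, 4), (6, 6, 6), (7, 7, 5), (8, 8, 6), (9, 9, 4), (10, 10, 5)]" by code_simp

text \<open>For an odd prime factor \<open>\<rho>\<close> of \<open>m\<close> the factor \<open>geom \<rho> b\<close> is used. Its prime divisors other than \<open>\<rho>\<close> are \<open>1\<close> modulo \<open>\<rho>\<close>, so
\<open>y\<close> is \<open>1\<close> modulo \<open>2 \<rho>\<close> and the listed primes cannot occur in it.\<close>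

lemma cubic_2_14: "list_all (check_u 3 1 3 True 6 7 [5, 11, 17])
  [(2, 2, 6), (3, 3, 5), (4, 4, 6), (5, 5, 4), (6, 6, 6), (7, 7, 4), (8, 8, 5), (9, 9, 4), (10, 10, 4),
   (11, 11, 4), (12, 4, 8), (13, 13, 4), (14, 14, 4)]" by code_simp

lemma cubic_15_23: "list_all (check_u 3 1 3 True 6 7 [5, 11, 17])
  [(15, 15, 4), (16, 16, 5), (17, 17, 3), (18, 2, 14), (19, 19, 4), (20, 4, 9), (21, 21, 4), (22, 22, 3), (23, 23, 3)]" by code_simp

lemma quintic_2_4: "list_all (check_u 5 1 5 True 10 11 [3, 7, 13]) [(2, 2, 9), (3, 3, 8), (4, 4, 9)]" by code_simp

lemma quintic_5: "list_all (check_u 5 1 5 True 10 11 [3, 7, 13]) [(5, 5, 8)]" by code_simp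

lemma quintic_6: "list_all (check_u 5 1 5 True 10 11 [3, 7, 13]) [(6, 2, 18)]" by code_simp

lemma septic_checked: "list_all (check_u 7 1 7 True 14 15 [3, 5, 11, 13]) [(2, 2, 12), (3, 3, 11)]" by code_simp

lemma eleven_checked: "list_all (check_u 11 1 11 True 22 23 [3, 5, 7, 13]) [(2, 2, 17)]" by code_simp

lemma thirteen_checked: "list_all (check_u 13 1 13 True 26 27 [3, 5, 7, 11]) [(2, 2, 18)]" by code_simp

section \<open>Exclusion of all exponents above two\<close>

lemma le_from_power_le: "(x::nat) ^ k \<le> B \<Longrightarrow> B < (c + 1) ^ k \<Longrightarrow> x \<le> c"
  by (rule ccontr) (use power_mono[of "c + 1" x k] in auto)

lemma linear_table: "2 \<le> u \<Longrightarrow> u \<le> 113 \<Longrightarrow> \<exists>e. check_linear e (int u)"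
proof -
  assume u: "2 \<le> u" "u \<le> 113"
  have *: "check_linear e (int u)" if "list_all (check_linear e) [a..b]" "a \<le> int u" "int u \<le> b" for a b e
    using that by (simp add: list_all_iff)
  consider "u = 2" | "3 \<le> u" "u \<le> 6" | "7 \<le> u" "u \<le> 33" | "34 \<le> u" "u \<le> 60" | "61 \<le> u" "u \<le> 75"
    | "76 \<le> u" "u \<le> 88" | "89 \<le> u" using u by linarith
  then show ?thesis
    by cases (use u linear_2 *[OF linear_3_6] *[OF linear_7_33] *[OF linear_34_60] *[OF linear_61_75] *[OF linear_76_88] *[OF linear_89_113] in auto)
qed

text \<open>From \<open>u\<^sup>n < n v\<^sup>n\<close> and \<open>n ^ (1 / n) \<le> 3 ^ (1 / 3)\<close> one gets \<open>u\<^sup>3 < 3 v\<^sup>3\<close>, and \<open>u v \<le> 8896\<close> then bounds \<open>u\<close> by \<open>113\<close>.\<close>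

lemma linear_case:
  fixes n n1 n2 u v :: nat
  assumes n: "3 \<le> n" "n = n1 * n2" and u: "2 \<le> u" and v: "2 \<le> v" and uv: "u * v \<le> 8896"
    and eq: "n2 * v ^ n = n1 * u ^ n + 1"
  shows False
proof -
  have n12: "0 < n1" "0 < n2" using n by (cases n1; cases n2; simp)+
  have cop: "coprime u v"
  proof (rule coprimeI)
    fix c assume c: "c dvd u" "c dvd v"
    have "c dvd n2 * v ^ n" "c dvd n1 * u ^ n" using c n(1) by (auto intro!: dvd_mult intro: dvd_trans[OF _ dvd_power])
    then show "is_unit c" using eq dvd_add_right_iff by metis
  qed
  have sol: "solution 2 1 1 u n n1 n2 v"
    using n u v uv n12 cop eq by (auto simp: solution_def geom_2 mult.commute)
  have D: "1 = 1 * (2 - 1 :: nat)" "u = u ^ 1" by simp_all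
  note S = sol_below[OF sol _ _ _ D]  check_u_sound[OF sol _ _ _ D]
  have "u ^ n < 1 * n * v ^ n" using S(1) by simp
  then have "u ^ 3 < 3 * 1 * v ^ 3" using n by (intro ratio_bound_below[where n = n]) auto
  then have "u ^ 3 * u ^ 3 \<le> 3 * v ^ 3 * u ^ 3" by (intro mult_right_mono) auto
  also have "\<dots> = 3 * (u * v) ^ 3" by (simp add: power_mult_distrib)
  also have "\<dots> \<le> 3 * 8896 ^ 3" using uv by (intro mult_left_mono power_mono) auto
  finally have "u ^ 6 \<le> 3 * 8896 ^ 3" by (simp flip: power_add)
  then have "u \<le> 113" by (rule le_from_power_le) simp
  then obtain e where e: "check_linear e (int u)" using linear_table u by blast
  have sk: "v \<noteq> u + 1 \<and> u \<noteq> v + 1" if "10 \<le> u"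
    using not_consecutive_above[of n2 u n n1] not_consecutive_below[of n2 v n n1] eq n that by auto
  show False
  proof (cases "even u")
    case True
    then have "odd v" using cop by (metis coprime_common_divisor odd_one)
    then have "int v mod 2 = 1" by presburger
    then have "[int v = 3] (mod 2)" by (simp add: cong_def)
    moreover have "int u mod 2 = 0" using True by presburger
    then have "check_u 2 1 (int 1) False 2 3 [] (int u, int u, e)" using e by (simp add: check_linear_def)
    ultimately show False using S(2)[of False 2 3 "[]" "int u" e] sk by simp
  next
    case False
    then have "int u mod 2 \<noteq> 0" by presburger
    then have "check_u 2 1 (int 1) False 1 2 [] (int u, int u, e)" using e by (simp add: check_linear_def)
    then show False using S(2)[of False 1 2 "[]" "int u" e] sk by simp
  qed
qed

lemma solution_exists:
  fixes n n1 n2 u v \<rho> k t m :: nat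
  assumes n: "3 \<le> n" "n = n1 * n2" and u: "2 \<le> u" and uv: "u * v \<le> 8896" and m: "m = k * \<rho> * t" "1 \<le> m"
    and eq: "geom m (n1 * u ^ n) = n2 * v ^ n"
    and \<rho>: "prime \<rho>" "\<And>q. prime q \<Longrightarrow> q dvd m \<Longrightarrow> q \<le> \<rho>"
    and sq: "\<not> \<rho> ^ 2 dvd geom \<rho> ((n1 * u ^ n) ^ k)" and k: "1 \<le> k"
  obtains C y where "solution \<rho> k \<rho> u n n1 C y" "\<not> \<rho> dvd y" "\<And>p. prime p \<Longrightarrow> p dvd y \<Longrightarrow> \<rho> dvd p - 1"
proof -
  define b where "b = n1 * u ^ n"
  have n12: "0 < n1" "0 < n2" using n by (cases n1; cases n2; simp)+
  have n2n: "n2 \<le> n" using n(2) n12 by simp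
  have "2 ^ n \<le> u ^ n" using u by (intro power_mono) auto
  also have "\<dots> \<le> b" using n12 by (simp add: b_def)
  finally have b: "2 ^ n \<le> b" .
  have "(2::nat) ^ 1 \<le> 2 ^ n" using n(1) by (intro power_increasing) auto
  then have b2: "2 \<le> b" using b by simp
  have eqb: "geom m b = n2 * v ^ n" using eq by (simp add: b_def)
  have n1': "1 \<le> n" using n(1) by simp
  obtain C y where C: "geom \<rho> (b ^ k) = C * y ^ n" "C dvd \<rho> * n2" "y dvd v" "\<not> \<rho> dvd y"
    "\<And>p. prime p \<Longrightarrow> p dvd y \<Longrightarrow> \<rho> dvd p - 1"
    using extract_factor[OF eqb b2 n1' m \<rho>] sq unfolding b_def by blast
  have y2: "2 \<le> y" using y_at_least_two[OF C(1,2) n12(2) n2n _ b k] prime_ge_2_nat[OF \<rho>(1)] by simp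
  have "0 < geom \<rho> (b ^ k)" using prime_gt_0_nat[OF \<rho>(1)] by (rule geom_pos)
  then have C0: "0 < C" using C(1) by (cases C) auto
  have "C * n1 dvd \<rho> * n2 * n1" using C(2) by (rule mult_dvd_mono) simp
  then have Cd: "C * n1 dvd \<rho> * n" by (simp add: n(2) mult_ac)
  have "coprime b (geom m b)" using m(2) by (intro coprime_geom) simp
  then have cv: "coprime u v"
  proof -
    have "u dvd b" using n(1) by (simp add: b_def dvd_mult)
    moreover have "v dvd geom m b" using n(1) by (simp add: eqb dvd_mult)
    ultimately show ?thesis using \<open>coprime b (geom m b)\<close> by (meson coprime_divisors)
  qed
  then have cy: "coprime u y" using C(3) by (meson coprime_divisors dvd_refl)
  have "v \<noteq> 0"
  proof
    assume "v = 0"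
    then have "geom m b = 0" using eqb n(1) by (simp add: power_0_left)
    then show False using geom_pos[of m b] m(2) by simp
  qed
  then have "y \<le> v" using C(3) by (intro dvd_imp_le) auto
  then have uy: "u * y \<le> 8896" using uv mult_le_mono2[of y v u] by linarith
  have "solution \<rho> k \<rho> u n n1 C y"
    using n u y2 n12 C0 Cd cy uy C(1) by (simp add: solution_def b_def)
  then show ?thesis using that C by blast
qed

lemma odd_case:
  fixes n n1 n2 u v \<rho> t m :: nat
  assumes n: "3 \<le> n" "n = n1 * n2" and u: "2 \<le> u" and uv: "u * v \<le> 8896" and m: "m = \<rho> * t" "1 \<le> m"
    and eq: "geom m (n1 * u ^ n) = n2 * v ^ n"
    and \<rho>: "prime \<rho>" "odd \<rho>" "\<And>q. prime q \<Longrightarrow> q dvd m \<Longrightarrow> q \<le> \<rho>"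
    and tbl: "check_u \<rho> 1 (int \<rho>) True (2 * int \<rho>) (2 * int \<rho> + 1) excl (int u, g, e)"
    and ex: "\<And>p. p \<in> set excl \<Longrightarrow> prime (nat p) \<and> \<not> \<rho> dvd nat p - 1"
  shows False
proof -
  have m': "m = 1 * \<rho> * t" using m by simp
  have sq: "\<not> \<rho> ^ 2 dvd geom \<rho> ((n1 * u ^ n) ^ 1)" using not_square_dvd_geom[OF \<rho>(1,2)] by blast
  obtain C y where sol: "solution \<rho> 1 \<rho> u n n1 C y" and y: "\<not> \<rho> dvd y" "\<And>p. prime p \<Longrightarrow> p dvd y \<Longrightarrow> \<rho> dvd p - 1"
    using solution_exists[OF n u uv m' m(2) eq \<rho>(1,3) sq] by auto
  have r2: "2 \<le> \<rho>" "1 \<le> \<rho>" using prime_ge_2_nat[OF \<rho>(1)] by auto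
  have D: "1 * (\<rho> - 1) = 1 * (\<rho> - 1)" "u ^ (1 * (\<rho> - 1)) = u ^ (1 * (\<rho> - 1))" by simp_all
  note F = sol_facts[OF sol r2(1) order_refl r2(2) D]
  have p1: "[p = 1] (mod \<rho>)" if "prime p" "p dvd y" for p
    using y(2)[OF that] prime_gt_0_nat[OF that(1)] cong_altdef_nat[of 1 p \<rho>] cong_sym by auto
  have y1: "[y = 1] (mod \<rho>)"
  proof (rule cong_one_if_primes)
    show "0 < y" using F(2) by simp
  qed (rule p1)
  have "odd (C * y ^ n)" using odd_geom[OF \<rho>(2)] F(10) by simp
  then have "odd y" using F(3) by simp
  then have "[y = 1] (mod 2)" by (simp add: cong_def odd_iff_mod_2_eq_one)
  then have "[y = 1] (mod 2 * \<rho>)" using y1 \<rho>(2) by (intro coprime_cong_mult_nat) auto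
  then have yi: "[int y = int 1] (mod int (2 * \<rho>))" by (simp only: cong_int_iff)
  have st: "[int y = 2 * int \<rho> + 1] (mod 2 * int \<rho>)"
    using yi by (simp add: cong_def)
  have T1: "1 \<le> (n1 * u ^ n) ^ 1" using F(1,4) by simp
  have ad: "admissible \<rho> (int C)" using admissible_odd[OF \<rho>(1,2) T1 F(10)[symmetric] y1] .
  have nd: "\<not> p dvd int y" if "p \<in> set excl" for p
  proof
    assume d: "p dvd int y"
    have pp: "prime (nat p)" "\<not> \<rho> dvd nat p - 1" using ex[OF that] by auto
    then have "int (nat p) = p" using prime_gt_0_nat[OF pp(1)] by simp
    then have "nat p dvd y" using d by (metis of_nat_dvd_iff)
    then show False using y(2) pp by blast
  qed
  show False
    using check_u_sound[OF sol r2(1) order_refl r2(2) D tbl nd] ad st \<rho>(1) prime_gt_0_nat[OF \<rho>(1)] by simp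
qed

lemma power_of_two_case:
  fixes n n1 n2 u v t m :: nat
  assumes n: "3 \<le> n" "n = n1 * n2" and u: "2 \<le> u" and uv: "u * v \<le> 8896" and m: "m = 4 * t" "1 \<le> m"
    and eq: "geom m (n1 * u ^ n) = n2 * v ^ n"
    and \<rho>: "\<And>q. prime q \<Longrightarrow> q dvd m \<Longrightarrow> q \<le> 2"
    and tbl: "check_u 2 2 2 True 4 5 excl (int u, g, e)"
    and ex: "\<And>p. p \<in> set excl \<Longrightarrow> prime (nat p) \<and> nat p mod 4 = 3"
  shows False
proof -
  define b where "b = n1 * u ^ n"
  have A: "geom 2 (b ^ 2) = b ^ 2 + 1" by (simp add: geom_2)
  have b4: "b ^ 2 mod 4 = 0 \<or> b ^ 2 mod 4 = 1"
  proof -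
    have "b ^ 2 mod 4 = (b mod 4) ^ 2 mod 4" by (simp add: power_mod)
    moreover have "b mod 4 = 0 \<or> b mod 4 = 1 \<or> b mod 4 = 2 \<or> b mod 4 = 3" by presburger
    ultimately show ?thesis by auto
  qed
  have sq: "\<not> 2 ^ 2 dvd geom 2 ((n1 * u ^ n) ^ 2)"
  proof
    assume "2 ^ 2 dvd geom 2 ((n1 * u ^ n) ^ 2)"
    then have "4 dvd b ^ 2 + 1" using A by (simp add: b_def)
    then show False using b4 by presburger
  qed
  have m': "m = 2 * 2 * t" using m by simp
  have r12: "1 \<le> (2::nat)" by simp
  obtain C y where sol: "solution 2 2 2 u n n1 C y" and y: "odd y"
    by (rule solution_exists[OF n u uv m' m(2) eq two_is_prime_nat \<rho> sq r12]) (assumption | simp)+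
  have r2: "2 \<le> (2::nat)" "1 \<le> (2::nat)" by auto
  have D: "2 * (2 - 1) = 2 * (2 - 1 :: nat)" "u ^ (2 * (2 - 1)) = u ^ (2 * (2 - 1))" by simp_all
  note F = sol_facts[OF sol r2(1) r2(2) r2(2) D]
  have Ae: "C * y ^ n = b ^ 2 + 1" using F(10) A by (simp add: b_def)
  have p4: "[p = 1] (mod 4)" if "prime p" "p dvd y" for p
  proof (rule mod_four_square_plus[OF _ that(1)])
    have "p dvd y ^ n" using that(2) F(3) by (intro dvd_trans[OF _ dvd_power]) auto
    then show "p dvd b ^ 2 + 1" unfolding Ae[symmetric] by (rule dvd_mult)
    show "p \<noteq> 2" using that(2) y by auto
  qed
  have y1: "[y = 1] (mod 4)"
  proof (rule cong_one_if_primes)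
    show "0 < y" using F(2) by simp
  qed (rule p4)
  then have "[int y = int 1] (mod int 4)" by (simp only: cong_int_iff)
  then have st: "[int y = 5] (mod 4)" by (simp add: cong_def)
  have "[C * y ^ n = C * 1 ^ n] (mod 4)" using y1 by (intro cong_mult cong_pow) auto
  then have "C mod 4 = (b ^ 2 + 1) mod 4" by (simp add: Ae cong_def)
  then have "C mod 4 = 1 \<or> C mod 4 = 2" using b4 by presburger
  then have "int C mod 4 = 1 \<or> int C mod 4 = 2" by presburger
  then have ad: "admissible 2 (int C)" by (simp add: admissible_def)
  have nd: "\<not> p dvd int y" if "p \<in> set excl" for p
  proof
    assume d: "p dvd int y"
    have pp: "prime (nat p)" "nat p mod 4 = 3" using ex[OF that] by auto
    then have "int (nat p) = p" using prime_gt_0_nat[OF pp(1)] by simp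
    then have "nat p dvd y" using d by (metis of_nat_dvd_iff)
    then have "[nat p = 1] (mod 4)" using p4 pp by blast
    then show False using pp(2) by (simp add: cong_def)
  qed
  have tbl': "check_u 2 2 (int 2) True 4 5 excl (int u, g, e)" using tbl by simp
  show False
    using check_u_sound[OF sol r2(1) r2(2) r2(2) D tbl' nd] ad st by simp
qed

lemma table_lookup:
  assumes "list_all P tbl" "map fst tbl = map int [a..<c]" "a \<le> u" "u < c"
  obtains g :: int and e :: nat where "P (int u, g, e)"
proof -
  have "int u \<in> set (map fst tbl)" unfolding assms(2) using assms(3,4) by simp
  then obtain g e where "(int u, g, e) \<in> set tbl" by auto
  then show ?thesis using that assms(1) by (auto simp: list_all_iff)
qed

lemma m_primes:
  fixes q m :: nat
  assumes "prime q" "q dvd m"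
  shows "m \<in> {3, 6, 9, 12} \<Longrightarrow> q \<le> 3" "m \<in> {4, 8} \<Longrightarrow> q \<le> 2" "m \<in> {5, 10} \<Longrightarrow> q \<le> 5" "m \<in> {7, 11, 13} \<Longrightarrow> q \<le> m"
proof -
  have two: "q \<le> 2" if "q dvd 2 ^ i" for i using that assms(1) prime_dvd_power[of q 2 i] dvd_imp_le[of q 2] by auto
  have three: "q \<le> 3" if "q dvd 2 ^ i * 3 ^ j" for i j
    using that assms(1) two[of i] prime_dvd_power[of q 3 j] dvd_imp_le[of q 3] by (auto simp: prime_dvd_mult_iff)
  show "m \<in> {3, 6, 9, 12} \<Longrightarrow> q \<le> 3"
    using assms(2) three[of 0 1] three[of 1 1] three[of 0 2] three[of 2 1] by auto
  show "m \<in> {4, 8} \<Longrightarrow> q \<le> 2" using assms(2) two[of 2] two[of 3] by auto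
  show "m \<in> {5, 10} \<Longrightarrow> q \<le> 5"
    using assms two[of 1] prime_dvd_mult_iff[of q 2 5] dvd_imp_le[of q 5] by auto
  show "m \<in> {7, 11, 13} \<Longrightarrow> q \<le> m" using assms(2) dvd_imp_le[of q m] by auto
qed

text \<open>The largest prime factor of \<open>m\<close> selects the table. For \<open>m = 4\<close> and \<open>m = 8\<close> the factor \<open>b\<^sup>2 + 1\<close> is preferred to \<open>b + 1\<close>,
which may contain a high power of \<open>2\<close> shared with the cofactor.\<close>

lemma no_solution_from_three:
  fixes b m n s :: nat
  assumes eq: "b * geom m b = n * s ^ n" and b: "2 \<le> b" and m: "2 \<le> m" and n: "3 \<le> n" and s: "2 \<le> s" "s \<le> 8896"
  shows False
proof -
  have mn: "1 \<le> m" "1 \<le> n" using m n by auto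
  obtain n1 n2 u v where f: "b = n1 * u ^ n" "geom m b = n2 * v ^ n" "n = n1 * n2" "s = u * v"
    by (rule split_equation[OF eq b mn]) (rule that)
  have n12: "0 < n1" "0 < n2" using f(3) n by (cases n1; cases n2; simp)+
  have uv0: "0 < u" "0 < v" using s f(4) by (cases u; cases v; simp)+
  show False
  proof (cases "u = 1")
    case True
    then show False using no_solution_b_dvd_n[OF b m, of v n2] f s by simp
  next
    case False
    then have u: "2 \<le> u" using uv0 by simp
    show False
    proof (cases "v = 1")
      case True
      have "n < 2 ^ n" by (rule less_exp)
      also have "\<dots> \<le> u ^ n" using u by (intro power_mono) auto
      also have "\<dots> \<le> b" using n12 by (simp add: f(1))
      also have "b ^ 1 \<le> b ^ (m - 1)" using b m by (intro power_increasing) auto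
      also have "\<dots> \<le> geom m b" using geom_ge_power[where m = "m - 1" and b = b] m by simp
      also have "\<dots> = n2" using f(2) True by simp
      also have "n2 \<le> n" using f(3) n12 by simp
      finally show False by simp
    next
      case False
      then have v: "2 \<le> v" using uv0 by simp
      have uv: "u * v \<le> 8896" using f(4) s(2) by simp
      have um: "u ^ m \<le> 13344" using u_power_bound[OF power_bound[OF eq f(1)] n s(2)] n12 m by simp
      have "2 ^ m \<le> u ^ m" using u by (intro power_mono) auto
      then have "(2::nat) ^ m < 2 ^ 14" using um by simp
      then have "m < 14" by (intro power_less_imp_less_exp[of "2 :: nat" m 14]) auto
      then have m13: "m \<le> 13" by simp
      have eqm: "geom m (n1 * u ^ n) = n2 * v ^ n" using f(1,2) by simp
      have m1: "1 \<le> m" using m by simp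
      have ub: "u \<le> c" if "k \<le> m" "13344 < (c + 1) ^ k" for c k
      proof -
        have "u ^ k \<le> u ^ m" using that(1) u by (intro power_increasing) auto
        then show ?thesis using um that(2) by (intro le_from_power_le[of u k 13344]) auto
      qed
      have "m = 2 \<or> m = 3 \<or> m = 4 \<or> m = 5 \<or> m = 6 \<or> m = 7 \<or> m = 8 \<or> m = 9 \<or> m = 10 \<or> m = 11 \<or> m = 12 \<or> m = 13" using m m13 by presburger
      then consider "m = 2" | "m \<in> {4, 8}" | "m \<in> {3, 6, 9, 12}" | "m \<in> {5, 10}" | "m = 7" | "m = 11" | "m = 13"
        by auto
      then show False
      proof cases
        case 1
        then show False using linear_case[OF n f(3) u v uv] eqm by (simp add: geom_2)
      next
        case 2
        then have "u < 11" using ub[of 4 10] by auto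
        then obtain g e where c: "check_u 2 2 2 True 4 5 [3, 7, 11] (int u, g, e)"
          using table_lookup[OF quartic_checked, of 2 11 u] u by (auto simp: upt_rec)
        obtain t where "m = 4 * t" using 2 that[of 1] that[of 2] by auto
        then show False
          by (rule power_of_two_case[OF n f(3) u uv _ m1 eqm m_primes(2)[OF _ _ 2] c]) auto
      next
        case 3
        then have "u < 24" using ub[of 3 23] by auto
        then obtain g e where c: "check_u 3 1 3 True 6 7 [5, 11, 17] (int u, g, e)"
          using table_lookup[OF cubic_2_14, of 2 15 u] table_lookup[OF cubic_15_23, of 15 24 u] u
          by (cases "u < 15") (auto simp: upt_rec)
        obtain t where "m = 3 * t" using 3 that[of 1] that[of 2] that[of 3] that[of 4] by auto
        then show False
          by (rule odd_case[OF n f(3) u uv _ m1 eqm _ _ m_primes(1)[OF _ _ 3], where excl = "[5, 11, 17]" and g = g and e = e])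
            (use c in auto)
      next
        case 4
        then have "u < 7" using ub[of 5 6] by auto
        then have "u = 5 \<or> u = 6 \<or> u < 5" by auto
        then obtain g e where c: "check_u 5 1 5 True 10 11 [3, 7, 13] (int u, g, e)"
          using table_lookup[OF quintic_2_4, of 2 5 u] quintic_5 quintic_6 u by (auto simp: upt_rec)
        obtain t where "m = 5 * t" using 4 that[of 1] that[of 2] by auto
        then show False
          by (rule odd_case[OF n f(3) u uv _ m1 eqm _ _ m_primes(3)[OF _ _ 4], where excl = "[3, 7, 13]" and g = g and e = e])
            (use c in auto)
      next
        case 5
        then have "u < 4" using ub[of 7 3] by auto
        then obtain g e where c: "check_u 7 1 7 True 14 15 [3, 5, 11, 13] (int u, g, e)"
          using table_lookup[OF septic_checked, of 2 4 u] u by (auto simp: upt_rec)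
        have q: "q \<le> 7" if "prime q" "q dvd m" for q using m_primes(4)[OF that] 5 by simp
        have "m = 7 * 1" using 5 by simp
        then show False
          by (rule odd_case[OF n f(3) u uv _ m1 eqm _ _ q, where excl = "[3, 5, 11, 13]" and g = g and e = e])
            (use c in auto)
      next
        case 6
        then have "u = 2" using ub[of 11 2] u by auto
        then have c: "check_u 11 1 11 True 22 23 [3, 5, 7, 13] (int u, 2, 17)" using eleven_checked by simp
        have q: "q \<le> 11" if "prime q" "q dvd m" for q using m_primes(4)[OF that] 6 by simp
        have "m = 11 * 1" using 6 by simp
        then show False
          by (rule odd_case[OF n f(3) u uv _ m1 eqm _ _ q, where excl = "[3, 5, 7, 13]" and g = 2 and e = 17])
            (use c in auto)
      next
        case 7
        then have "u = 2" using ub[of 13 2] u by auto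
        then have c: "check_u 13 1 13 True 26 27 [3, 5, 7, 11] (int u, 2, 18)" using thirteen_checked by simp
        have q: "q \<le> 13" if "prime q" "q dvd m" for q using m_primes(4)[OF that] 7 by simp
        have "m = 13 * 1" using 7 by simp
        then show False
          by (rule odd_case[OF n f(3) u uv _ m1 eqm _ _ q, where excl = "[3, 5, 7, 11]" and g = 2 and e = 18])
            (use c in auto)
      qed
    qed
  qed
qed

lemma no_solution_two:
  fixes b m s :: nat
  assumes eq: "b * geom m b = 2 * s ^ 2" and b: "2 \<le> b" and m: "3 \<le> m" and s: "2 \<le> s" "s \<le> 8896"
  shows False
proof -
  have mn: "1 \<le> m" "1 \<le> (2::nat)" using m by auto
  obtain n1 n2 u v where f: "b = n1 * u ^ 2" "geom m b = n2 * v ^ 2" "2 = n1 * n2" "s = u * v"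
    by (rule split_equation[OF eq b mn]) (rule that)
  have n12: "n1 = 1 \<and> n2 = 2 \<or> n1 = 2 \<and> n2 = 1"
  proof -
    have "n1 dvd 2" using f(3) by (metis dvd_triv_left)
    then have "n1 \<le> 2" by (rule dvd_imp_le) simp
    moreover have "n1 \<noteq> 0" using f(3) by (cases n1) auto
    ultimately have "n1 = 1 \<or> n1 = 2" by linarith
    then show ?thesis using f(3) by auto
  qed
  have uv0: "0 < u" "0 < v" using s f(4) by (cases u; cases v; simp)+
  show False
  proof (cases "u = 1")
    case True
    then have "v = s" "b * n2 = 2" using f by simp_all
    then show False using no_solution_b_dvd_n[OF b _ _ _, of m v n2] f(2) s m by simp
  next
    case False
    then have u: "2 \<le> u" using uv0 by simp
    have "(u ^ m) ^ 2 \<le> 2 * s ^ 2" using power_bound[OF eq f(1)] n12 m by auto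
    also have "\<dots> \<le> 2 * 8896 ^ 2" using s(2) by (intro mult_left_mono power_mono) auto
    finally have um: "u ^ m \<le> 12581" by (rule le_from_power_le) simp
    have "2 ^ m \<le> u ^ m" using u by (intro power_mono) auto
    then have "(2::nat) ^ m < 2 ^ 14" using um by simp
    then have "m < 14" by (intro power_less_imp_less_exp[of "2 :: nat" m 14]) auto
    then have m13: "m \<le> 13" by simp
    have "u ^ 3 \<le> u ^ m" using m u by (intro power_increasing) auto
    then have "u ^ 3 \<le> 12581" using um by simp
    then have u23: "u \<le> 23" by (rule le_from_power_le) simp
    have "m \<in> set [3, 4, 5, 6, 7, 8, 9, 10, 11, 12, 13]"
    proof -
      have "m = 3 \<or> m = 4 \<or> m = 5 \<or> m = 6 \<or> m = 7 \<or> m = 8 \<or> m = 9 \<or> m = 10 \<or> m = 11 \<or> m = 12 \<or> m = 13" using m m13 by presburger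
      then show ?thesis by auto
    qed
    then have all_u: "list_all (check_square m) [2..23]" using squares_checked unfolding list_all_iff by blast
    have "int u \<in> set [2..23]" unfolding set_upto using u u23 by simp
    then have "check_square m (int u)" by (rule bspec[OF all_u[unfolded list_all_iff]])
    moreover have "int u ^ m \<le> 12581" using um by (metis of_nat_le_iff of_nat_numeral of_nat_power)
    ultimately have np: "not_power (int u) (geom_int m (int u ^ 2)) (int 2) 2" "not_power (int u) (geom_int m (2 * int u ^ 2)) (int 1) 2"
      by (auto simp: check_square_def)
    have uv: "u * v \<le> 8896" using f(4) s(2) by simp
    have e: "int n2 * int v ^ 2 = geom_int m (int b)" unfolding geom_int_eq using f(2) by simp
    show False
      using n12
    proof
      assume "n1 = 1 \<and> n2 = 2"
      then show False using not_power_sound[OF np(1) uv] e f(1) by simp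
    next
      assume "n1 = 2 \<and> n2 = 1"
      then show False using not_power_sound[OF np(2) uv] e f(1) by simp
    qed
  qed
qed

theorem theorem4p1:
  fixes s n :: nat
  assumes "2 \<le> s" and "s \<le> 8896" and "n \<ge> 1"
    and "repunit (cullen n s)"
  shows "(n = 1 \<and> cullen 1 s = s + 1 \<and> repunit (s + 1)) \<or>
         (n = 2 \<and> (\<exists>b::nat. b \<ge> 2 \<and> s ^ 2 = (b * (b + 1)) div 2
                        \<and> cullen 2 s = 2 * s ^ 2 + 1 \<and> 2 * s ^ 2 + 1 = b ^ 2 + b + 1))"
proof (cases "n = 1")
  case True
  then show ?thesis using assms(4) by (simp add: cullen_def)
next
  case False
  obtain b q where b: "2 \<le> b" "3 \<le> q" and eq0: "cullen n s = (\<Sum>i<q. b ^ i)"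
    using assms(4) unfolding repunit_iff_sum by blast
  define m where "m = q - 1"
  have q: "q = Suc m" "2 \<le> m" using b(2) by (auto simp: m_def)
  have "n * s ^ n + 1 = geom q b" using eq0 by (simp add: cullen_def geom_def)
  then have eq: "b * geom m b = n * s ^ n" by (simp add: q(1) geom_Suc)
  have n2: "n = 2" using no_solution_from_three[OF eq b(1) q(2) _ assms(1,2)] False assms(3) by force
  have m2: "m = 2" using no_solution_two[of b m s] eq n2 b(1) q(2) assms(1,2) by force
  have e: "2 * s ^ 2 = b * (b + 1)" using eq n2 m2 by (simp add: geom_2)
  then have "s ^ 2 = (b * (b + 1)) div 2" by (metis nonzero_mult_div_cancel_left zero_neq_numeral)
  moreover have "2 * s ^ 2 + 1 = b ^ 2 + b + 1" using e by (simp add: power2_eq_square)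
  ultimately show ?thesis using n2 b(1) by (auto simp: cullen_def)
qed

end
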